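(* Let $G$ be a graph of order $n$. (1) $BS(G)\le 3n/4+3/2$. (2) If $n\ge5$, then $BS_2(G)\le n-1$, with the only exception of the graph $H$ on $5$ vertices having exactly $2$ edges which share a vertex; for this graph $H$, $BS_3(H)\le 4$.
   Context: Graphs are finite simple undirected graphs, viewed as structures with a single binary (symmetric, irreflexive) adjacency relation $E$; the order is the number of vertices. A Bernays–Schönfinkel formula is a first-order formula over $\{E,=\}$ of the form $\exists y_1\ldots\exists y_p\forall x_1\ldots\forall x_r\,\Psi$ with $p,r\ge0$ and $\Psi$ quantifier-free. A closed formula identifies a graph $G$ of order $n$ if it is true on $G$ and false on every graph of order $n$ not isomorphic to $G$. $BS(G)$ is the minimum of $p+r$ over Bernays–Schönfinkel formulas identifying $G$; $BS_q(G)$ is the same minimum restricted to formulas with $r\le q$.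
   Formalization: In (2) the exceptions are H and its complement: BS_2 is invariant under complementation and BS_2(H)>4, so with H alone the claim fails for the complement of H. It is proved that BS_2(G)≤n-1 holds exactly when G is neither of them, and BS_3≤4 for both. *)

theory Defs
  imports "Graph_Theory.Graph_Theory" "HOL-Library.Extended_Real"
begin

text \<open>
  A finite simple undirected graph is a \<open>pair_graph\<close>: a finite vertex set \<open>pverts G\<close> with
  a symmetric, irreflexive adjacency relation \<open>parcs G\<close>, so an undirected edge contributes
  both of its orientations to \<open>parcs G\<close>.
\<close>

abbreviation graph_iso :: "'a pair_pre_digraph \<Rightarrow> 'b pair_pre_digraph \<Rightarrow> bool" where
  "graph_iso G H \<equiv> digraph_iso (with_proj G) (with_proj H)"

definition order :: "'a pair_pre_digraph \<Rightarrow> nat" where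
  "order G = card (pverts G)"

definition edges :: "'a pair_pre_digraph \<Rightarrow> 'a set set" where
  "edges G = {{u, v} |u v. (u, v) \<in> parcs G}"

text \<open>
  Replacing each atom \<open>E x y\<close> by \<open>\<not> E x y \<and> x \<noteq> y\<close> keeps the quantifier prefix, so \<open>BS_restr q\<close> takes
  the same value on a graph and on its complement: a graph that is exceptional for \<open>BS_restr 2\<close>
  has an exceptional complement.
\<close>

definition complement_graph :: "'a pair_pre_digraph \<Rightarrow> 'a pair_pre_digraph" where
  "complement_graph G =
    \<lparr> pverts = pverts G,
      parcs = {(u, v). u \<in> pverts G \<and> v \<in> pverts G \<and> u \<noteq> v \<and> (u, v) \<notin> parcs G} \<rparr>"

text \<open>\<open>G\<close> is (a copy of) the graph on 5 vertices with exactly 2 edges, which share a vertex.\<close>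

definition is_cherry5 :: "'a pair_pre_digraph \<Rightarrow> bool" where
  "is_cherry5 G \<longleftrightarrow>
    pair_graph G \<and> order G = 5 \<and>
    (\<exists>e f. edges G = {e, f} \<and> e \<noteq> f \<and> e \<inter> f \<noteq> {})"

datatype fo =
    FEq nat nat
  | FAdj nat nat
  | FNeg fo
  | FConj fo fo
  | FDisj fo fo
  | FEx nat fo
  | FAll nat fo

primrec qfree :: "fo \<Rightarrow> bool" where
  "qfree (FEq x y) = True"
| "qfree (FAdj x y) = True"
| "qfree (FNeg \<phi>) = qfree \<phi>"
| "qfree (FConj \<phi> \<psi>) = (qfree \<phi> \<and> qfree \<psi>)"
| "qfree (FDisj \<phi> \<psi>) = (qfree \<phi> \<and> qfree \<psi>)"
| "qfree (FEx x \<phi>) = False"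
| "qfree (FAll x \<phi>) = False"

primrec free_vars :: "fo \<Rightarrow> nat set" where
  "free_vars (FEq x y) = {x, y}"
| "free_vars (FAdj x y) = {x, y}"
| "free_vars (FNeg \<phi>) = free_vars \<phi>"
| "free_vars (FConj \<phi> \<psi>) = free_vars \<phi> \<union> free_vars \<psi>"
| "free_vars (FDisj \<phi> \<psi>) = free_vars \<phi> \<union> free_vars \<psi>"
| "free_vars (FEx x \<phi>) = free_vars \<phi> - {x}"
| "free_vars (FAll x \<phi>) = free_vars \<phi> - {x}"

definition closed_formula :: "fo \<Rightarrow> bool" where
  "closed_formula \<phi> \<longleftrightarrow> free_vars \<phi> = {}"

primrec sat :: "'a pair_pre_digraph \<Rightarrow> (nat \<Rightarrow> 'a) \<Rightarrow> fo \<Rightarrow> bool" where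
  "sat G s (FEq x y) \<longleftrightarrow> s x = s y"
| "sat G s (FAdj x y) \<longleftrightarrow> (s x, s y) \<in> parcs G"
| "sat G s (FNeg \<phi>) \<longleftrightarrow> \<not> sat G s \<phi>"
| "sat G s (FConj \<phi> \<psi>) \<longleftrightarrow> sat G s \<phi> \<and> sat G s \<psi>"
| "sat G s (FDisj \<phi> \<psi>) \<longleftrightarrow> sat G s \<phi> \<or> sat G s \<psi>"
| "sat G s (FEx x \<phi>) \<longleftrightarrow> (\<exists>v \<in> pverts G. sat G (s(x := v)) \<phi>)"
| "sat G s (FAll x \<phi>) \<longleftrightarrow> (\<forall>v \<in> pverts G. sat G (s(x := v)) \<phi>)"

text \<open>
  Only used for closed formulas, whose truth value does not depend on the assignment \<open>s\<close>.
\<close>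

definition true_on :: "fo \<Rightarrow> 'a pair_pre_digraph \<Rightarrow> bool" where
  "true_on \<phi> G \<longleftrightarrow> (\<forall>s. sat G s \<phi>)"

definition bs_formula :: "nat \<Rightarrow> nat \<Rightarrow> fo \<Rightarrow> bool" where
  "bs_formula p r \<phi> \<longleftrightarrow>
    (\<exists>ys xs \<Psi>. \<phi> = foldr FEx ys (foldr FAll xs \<Psi>) \<and> length ys = p \<and> length xs = r \<and>
       distinct (ys @ xs) \<and> qfree \<Psi>)"

text \<open>
  Letting \<open>H\<close> range over graphs with vertices in the same type \<open>'a\<close> as \<open>G\<close> loses nothing: every
  graph of the same order as \<open>G\<close> has an isomorphic copy with vertex set \<open>pverts G\<close>.
\<close>

definition identifies :: "fo \<Rightarrow> 'a pair_pre_digraph \<Rightarrow> bool" where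
  "identifies \<phi> G \<longleftrightarrow>
    closed_formula \<phi> \<and> true_on \<phi> G \<and>
    (\<forall>H :: 'a pair_pre_digraph.
       pair_graph H \<and> order H = order G \<and> \<not> graph_iso G H \<longrightarrow> \<not> true_on \<phi> H)"

text \<open>
  The minima are taken in \<open>enat\<close>, so that an empty set of identifying formulas would give
  \<open>\<infinity>\<close> and an upper bound on the minimum entails the existence of an identifying formula.
\<close>

definition BS :: "'a pair_pre_digraph \<Rightarrow> enat" where
  "BS G = Inf {enat (p + r) |p r. \<exists>\<phi>. bs_formula p r \<phi> \<and> identifies \<phi> G}"

definition BS_restr :: "nat \<Rightarrow> 'a pair_pre_digraph \<Rightarrow> enat" where
  "BS_restr q G = Inf {enat (p + r) |p r. r \<le> q \<and> (\<exists>\<phi>. bs_formula p r \<phi> \<and> identifies \<phi> G)}"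

end

theory Submission
  imports Defs
begin

text \<open>
  A formula with \<open>p\<close> existential and \<open>r\<close> universal quantifiers can be chosen as the complete
  description of \<open>r\<close>-tuples over \<open>p\<close> named vertices \<open>A\<close>. If any two vertices outside \<open>A\<close> with the same
  neighbours in \<open>A\<close> are twins, then such a description identifies \<open>G\<close> as soon as \<open>r \<ge> 2\<close> and either
  \<open>r\<close> exceeds the size of every class of vertices with equal neighbours in \<open>A\<close> (which bounds, hence
  fixes, the class sizes) or there is only one class.

  For the first bound, grow \<open>X\<close> as long as its number of classes exceeds \<open>card X\<close>. Then a vertex in a
  non-singleton class splits no class, so the remaining splitting is done by the singleton classes;
  adding greedily some of them gives such an \<open>A\<close> with \<open>3 card A + 2 m \<le> 2 n\<close>, where \<open>m\<close> is the
  largest class size. Use \<open>A\<close> with \<open>r = m + 1\<close> if \<open>m\<close> is small, and the complement of a largest class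
  with \<open>r = 2\<close> otherwise.

  For the second bound, it suffices to find three mutual twins or three vertices that are pairwise
  separated by the remaining ones. A set of representatives of the twin classes provides them, except
  for two twin pairs plus a fifth vertex, which is the exceptional graph or its complement. For these
  two graphs any admissible description also holds on a graph with a different number of edges.
\<close>

section \<open>Bernays-Schoenfinkel formulas and partial embeddings\<close>

lemma pair_graph_iff:
  "pair_graph G \<longleftrightarrow> finite (pverts G) \<and> parcs G \<subseteq> pverts G \<times> pverts G \<and>
    (\<forall>u v. (u, v) \<in> parcs G \<longrightarrow> (v, u) \<in> parcs G) \<and> (\<forall>u. (u, u) \<notin> parcs G)"
  (is "?l \<longleftrightarrow> ?r")
proof
  assume ?l
  then interpret pair_graph G .
  show ?r
    using pair_finite_verts arc_fst_in_verts arc_snd_in_verts pair_no_loops pair_sym_arcs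
    by (fastforce simp: symmetric_def sym_def)
next
  assume r: ?r
  then have "finite (parcs G)"
    by (meson finite_SigmaI finite_subset)
  with r show ?l
    by unfold_locales (auto simp: symmetric_def sym_def)
qed

text \<open>A library isomorphism moves vertices, arcs and end maps separately. Since both graphs
  have \<open>fst\<close> and \<open>snd\<close> as end maps, its arc part is forced to be the
  vertex part applied to both components, so only a vertex bijection remains.\<close>

lemma graph_iso_iff:
  assumes "pair_graph G" "pair_graph H"
  shows "graph_iso G H \<longleftrightarrow> (\<exists>h. bij_betw h (pverts G) (pverts H) \<and>
    (\<forall>u \<in> pverts G. \<forall>v \<in> pverts G. (u, v) \<in> parcs G \<longleftrightarrow> (h u, h v) \<in> parcs H))"
  (is "?l \<longleftrightarrow> (\<exists>h. ?P h)")
proof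
  interpret G: pair_graph G by fact
  assume ?l
  then obtain f where f: "pre_digraph.digraph_isomorphism (with_proj G) f"
    and H: "with_proj H = app_iso f (with_proj G)"
    unfolding digraph_iso_def by blast
  have ft: "iso_tail f = fst" "iso_head f = snd"
    using arg_cong[OF H, of tail] arg_cong[OF H, of head] by simp_all
  have V: "pverts H = iso_verts f ` pverts G" and E: "parcs H = iso_arcs f ` parcs G"
    using arg_cong[OF H, of verts] arg_cong[OF H, of arcs] by simp_all
  have inj: "inj_on (iso_verts f) (pverts G)"
    and arc: "\<And>a. a \<in> parcs G \<Longrightarrow> iso_arcs f a = (iso_verts f (fst a), iso_verts f (snd a))"
    using f ft by (auto simp: pre_digraph.digraph_isomorphism_def prod_eq_iff)
  have "(u, v) \<in> parcs G \<longleftrightarrow> (iso_verts f u, iso_verts f v) \<in> parcs H"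
    if "u \<in> pverts G" "v \<in> pverts G" for u v
  proof
    assume "(u, v) \<in> parcs G"
    then show "(iso_verts f u, iso_verts f v) \<in> parcs H"
      using arc[of "(u, v)"] E by (metis fst_conv imageI snd_conv)
  next
    assume "(iso_verts f u, iso_verts f v) \<in> parcs H"
    then obtain a where a: "a \<in> parcs G" "iso_arcs f a = (iso_verts f u, iso_verts f v)"
      unfolding E by force
    then have "fst a = u" "snd a = v"
      using arc[OF a(1)] inj that G.arc_fst_in_verts G.arc_snd_in_verts by (auto dest: inj_onD)
    with a show "(u, v) \<in> parcs G" by auto
  qed
  then show "\<exists>h. ?P h"
    using inj V by (intro exI[of _ "iso_verts f"]) (auto simp: bij_betw_def)
next
  interpret G: pair_graph G by fact
  interpret H: pair_graph H by fact
  assume "\<exists>h. ?P h"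
  then obtain h where h: "bij_betw h (pverts G) (pverts H)"
    and E: "\<And>u v. u \<in> pverts G \<Longrightarrow> v \<in> pverts G \<Longrightarrow> (u, v) \<in> parcs G \<longleftrightarrow> (h u, h v) \<in> parcs H"
    by blast
  define f where "f = \<lparr>iso_verts = h, iso_arcs = map_prod h h, iso_head = snd, iso_tail = fst\<rparr>"
  have sub: "parcs G \<subseteq> pverts G \<times> pverts G" "parcs H \<subseteq> pverts H \<times> pverts H"
    using assms by (auto simp: pair_graph_iff)
  have "inj_on (map_prod h h) (pverts G \<times> pverts G)"
    using h by (intro map_prod_inj_on) (auto simp: bij_betw_def)
  then have inj: "inj_on (map_prod h h) (parcs G)"
    using sub(1) by (rule inj_on_subset)
  have img: "map_prod h h ` parcs G = parcs H"
  proof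
    show "map_prod h h ` parcs G \<subseteq> parcs H"
      using E sub by auto
    show "parcs H \<subseteq> map_prod h h ` parcs G"
    proof
      fix e assume e: "e \<in> parcs H"
      then obtain u v where "u \<in> pverts G" "v \<in> pverts G" "e = (h u, h v)"
        using sub(2) h by (cases e) (auto simp: bij_betw_def; blast)
      with e E show "e \<in> map_prod h h ` parcs G" by force
    qed
  qed
  have "pre_digraph.digraph_isomorphism (with_proj G) f"
    unfolding pre_digraph.digraph_isomorphism_def
    using h inj G.wf_digraph_axioms by (auto simp: f_def bij_betw_def)
  moreover have "with_proj H = app_iso f (with_proj G)"
    using h img by (simp add: app_iso_def f_def with_proj_def bij_betw_def)
  ultimately show ?l unfolding digraph_iso_def by blast
qed

text \<open>
  The strongest formula with existential witnesses \<open>A\<close> and \<open>r\<close> universal variables that is true on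
  \<open>G\<close> holds on \<open>H\<close> iff \<open>back_embeds r A f G H\<close> for some \<open>f\<close>: every set of at most \<open>r\<close>
  vertices of \<open>H\<close> has to look, over the copy of \<open>A\<close>, like vertices of \<open>G\<close> over \<open>A\<close>.
\<close>

definition back_embeds ::
  "nat \<Rightarrow> 'a set \<Rightarrow> ('a \<Rightarrow> 'b) \<Rightarrow> 'a pair_pre_digraph \<Rightarrow> 'b pair_pre_digraph \<Rightarrow> bool" where
  "back_embeds r A f G H \<longleftrightarrow> f ` A \<subseteq> pverts H \<and>
    (\<forall>R \<subseteq> pverts H. card R \<le> r \<longrightarrow>
      (\<exists>g. inj_on g (f ` A \<union> R) \<and> g ` (f ` A \<union> R) \<subseteq> pverts G \<and> (\<forall>a \<in> A. g (f a) = a) \<and>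
        (\<forall>u \<in> f ` A \<union> R. \<forall>v \<in> f ` A \<union> R. (u, v) \<in> parcs H \<longleftrightarrow> (g u, g v) \<in> parcs G)))"

lemma back_embedsE:
  assumes "back_embeds r A f G H" "R \<subseteq> pverts H" "card R \<le> r"
  obtains g where "inj_on g (f ` A \<union> R)" "g ` (f ` A \<union> R) \<subseteq> pverts G" "\<forall>a \<in> A. g (f a) = a"
    "\<forall>u \<in> f ` A \<union> R. \<forall>v \<in> f ` A \<union> R. (u, v) \<in> parcs H \<longleftrightarrow> (g u, g v) \<in> parcs G"
proof -
  have "\<exists>g. inj_on g (f ` A \<union> R) \<and> g ` (f ` A \<union> R) \<subseteq> pverts G \<and> (\<forall>a \<in> A. g (f a) = a) \<and>
    (\<forall>u \<in> f ` A \<union> R. \<forall>v \<in> f ` A \<union> R. (u, v) \<in> parcs H \<longleftrightarrow> (g u, g v) \<in> parcs G)"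
    using assms unfolding back_embeds_def by simp
  then show ?thesis by (elim exE conjE) (rule that)
qed

text \<open>Formula-free counterpart of being identified with \<open>A\<close> as witnesses and
  \<open>r\<close> universal variables. The lemmas \<open>determined_by_imp_identifies\<close> and
  \<open>identifies_imp_determined_by\<close> translate in the two directions; the combinatorics is
  done for this predicate only.\<close>

definition determined_by :: "'a pair_pre_digraph \<Rightarrow> nat \<Rightarrow> 'a set \<Rightarrow> bool" where
  "determined_by G r A \<longleftrightarrow>
    (\<forall>H :: 'a pair_pre_digraph. pair_graph H \<and> order H = order G \<and> (\<exists>f. back_embeds r A f G H)
      \<longrightarrow> graph_iso G H)"

section \<open>Quantifier prefixes and quantifier-free matrices\<close>

lemma sat_foldr_FEx:
  "sat G s (foldr FEx ys \<phi>) \<longleftrightarrow>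
    (\<exists>t. (\<forall>i \<in> set ys. t i \<in> pverts G) \<and> (\<forall>i. i \<notin> set ys \<longrightarrow> t i = s i) \<and> sat G t \<phi>)"
proof (induction ys arbitrary: s)
  case Nil
  have "t = s" if "\<forall>i. t i = s i" for t using that by auto
  then show ?case by auto
next
  case (Cons y ys)
  show ?case
  proof
    assume "sat G s (foldr FEx (y # ys) \<phi>)"
    then show "\<exists>t. (\<forall>i \<in> set (y # ys). t i \<in> pverts G) \<and> (\<forall>i. i \<notin> set (y # ys) \<longrightarrow> t i = s i) \<and> sat G t \<phi>"
      by (auto simp: Cons.IH) (metis fun_upd_apply)
  next
    assume "\<exists>t. (\<forall>i \<in> set (y # ys). t i \<in> pverts G) \<and> (\<forall>i. i \<notin> set (y # ys) \<longrightarrow> t i = s i) \<and> sat G t \<phi>"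
    then obtain t where "\<forall>i \<in> set (y # ys). t i \<in> pverts G" "\<forall>i. i \<notin> set (y # ys) \<longrightarrow> t i = s i" "sat G t \<phi>"
      by blast
    then show "sat G s (foldr FEx (y # ys) \<phi>)"
      by (auto simp: Cons.IH intro!: bexI[of _ "t y"] exI[of _ t])
  qed
qed

lemma sat_foldr_FAll:
  "sat G s (foldr FAll xs \<phi>) \<longleftrightarrow>
    (\<forall>t. (\<forall>i \<in> set xs. t i \<in> pverts G) \<and> (\<forall>i. i \<notin> set xs \<longrightarrow> t i = s i) \<longrightarrow> sat G t \<phi>)"
proof -
  have "sat G s (foldr FAll xs \<phi>) \<longleftrightarrow> \<not> sat G s (foldr FEx xs (FNeg \<phi>))"
    by (induction xs arbitrary: s) auto
  then show ?thesis by (auto simp: sat_foldr_FEx)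
qed

lemma free_vars_foldr [simp]:
  "free_vars (foldr FEx ys \<phi>) = free_vars \<phi> - set ys"
  "free_vars (foldr FAll ys \<phi>) = free_vars \<phi> - set ys"
  by (induction ys) auto

lemma sat_qfree_cong:
  assumes "qfree \<phi>"
    and "\<And>i j. i \<in> free_vars \<phi> \<Longrightarrow> j \<in> free_vars \<phi> \<Longrightarrow>
      (s i = s j \<longleftrightarrow> t i = t j) \<and> ((s i, s j) \<in> parcs G \<longleftrightarrow> (t i, t j) \<in> parcs H)"
  shows "sat G s \<phi> \<longleftrightarrow> sat H t \<phi>"
  using assms by (induction \<phi>) auto

text \<open>Induction on the index set. The syntax has no constant for truth, so the empty
  conjunction is \<open>FEq 0 0\<close>, and \<open>N > 0\<close> makes the variable 0
  available.\<close>

lemma ex_qfree_conj: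
  assumes "finite I" "N > 0" "\<And>i. i \<in> I \<Longrightarrow> qfree (F i) \<and> free_vars (F i) \<subseteq> {..<N}"
  shows "\<exists>\<Psi>. qfree \<Psi> \<and> free_vars \<Psi> \<subseteq> {..<N} \<and>
    (\<forall>(G :: 'a pair_pre_digraph) s. sat G s \<Psi> \<longleftrightarrow> (\<forall>i \<in> I. sat G s (F i)))"
  using assms
proof (induction I rule: finite_induct)
  case empty
  then show ?case by (intro exI[of _ "FEq 0 0"]) auto
next
  case (insert i I)
  then obtain \<Psi> where "qfree \<Psi>" "free_vars \<Psi> \<subseteq> {..<N}"
    "\<forall>(G :: 'a pair_pre_digraph) s. sat G s \<Psi> \<longleftrightarrow> (\<forall>i \<in> I. sat G s (F i))"
    by auto
  with insert show ?case
    by (intro exI[of _ "FConj (F i) \<Psi>"]) auto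
qed

lemma ex_qfree_disj:
  assumes "finite I" "N > 0" "\<And>i. i \<in> I \<Longrightarrow> qfree (F i) \<and> free_vars (F i) \<subseteq> {..<N}"
  shows "\<exists>\<Psi>. qfree \<Psi> \<and> free_vars \<Psi> \<subseteq> {..<N} \<and>
    (\<forall>(G :: 'a pair_pre_digraph) s. sat G s \<Psi> \<longleftrightarrow> (\<exists>i \<in> I. sat G s (F i)))"
proof -
  obtain \<Psi> where "qfree \<Psi>" "free_vars \<Psi> \<subseteq> {..<N}"
    "\<forall>(G :: 'a pair_pre_digraph) s. sat G s \<Psi> \<longleftrightarrow> (\<forall>i \<in> I. sat G s (FNeg (F i)))"
    using ex_qfree_conj[of I N "\<lambda>i. FNeg (F i)"] assms by auto
  then show ?thesis by (intro exI[of _ "FNeg \<Psi>"]) auto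
qed

text \<open>The atomic diagram of the tuple \<open>s 0, ..., s (N - 1)\<close>. Coding it by sets of
  index pairs makes diagrams over different graphs comparable and leaves only finitely many for each
  \<open>N\<close>.\<close>

definition diagram :: "'a pair_pre_digraph \<Rightarrow> nat \<Rightarrow> (nat \<Rightarrow> 'a) \<Rightarrow> (nat \<times> nat) set \<times> (nat \<times> nat) set" where
  "diagram G N s =
    ({(i, j). i < N \<and> j < N \<and> s i = s j}, {(i, j). i < N \<and> j < N \<and> (s i, s j) \<in> parcs G})"

lemma diagram_eq_iff:
  "diagram G N s = diagram H N t \<longleftrightarrow>
    (\<forall>i < N. \<forall>j < N. (s i = s j \<longleftrightarrow> t i = t j) \<and> ((s i, s j) \<in> parcs G \<longleftrightarrow> (t i, t j) \<in> parcs H))"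
  unfolding diagram_def by (auto simp: set_eq_iff)

lemma ex_diagram_formula:
  assumes "N > 0"
  shows "\<exists>\<Psi>. qfree \<Psi> \<and> free_vars \<Psi> \<subseteq> {..<N} \<and>
    (\<forall>(G :: 'a pair_pre_digraph) s. sat G s \<Psi> \<longleftrightarrow>
      (\<forall>i < N. \<forall>j < N. (s i = s j \<longleftrightarrow> (i, j) \<in> P) \<and> ((s i, s j) \<in> parcs G \<longleftrightarrow> (i, j) \<in> Q)))"
proof -
  define lit where "lit b \<psi> = (if b then \<psi> else FNeg \<psi>)" for b \<psi>
  define F where "F = (\<lambda>(i, j). FConj (lit ((i, j) \<in> P) (FEq i j)) (lit ((i, j) \<in> Q) (FAdj i j)))"
  have "\<exists>\<Psi>. qfree \<Psi> \<and> free_vars \<Psi> \<subseteq> {..<N} \<and>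
    (\<forall>(G :: 'a pair_pre_digraph) s. sat G s \<Psi> \<longleftrightarrow> (\<forall>i \<in> {..<N} \<times> {..<N}. sat G s (F i)))"
    using assms by (intro ex_qfree_conj) (auto simp: F_def lit_def split: if_splits)
  moreover have "sat G s (F (i, j)) \<longleftrightarrow>
      (s i = s j \<longleftrightarrow> (i, j) \<in> P) \<and> ((s i, s j) \<in> parcs G \<longleftrightarrow> (i, j) \<in> Q)"
    for G :: "'a pair_pre_digraph" and s i j
    by (auto simp: F_def lit_def)
  ultimately show ?thesis by (auto simp: Ball_def)
qed

lemma ex_diagrams_formula:
  assumes "N > 0"
  shows "\<exists>\<Psi>. qfree \<Psi> \<and> free_vars \<Psi> \<subseteq> {..<N} \<and>
    (\<forall>(H :: 'a pair_pre_digraph) t. sat H t \<Psi> \<longleftrightarrow> (\<exists>s \<in> S. diagram H N t = diagram G N s))"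
proof -
  let ?D = "diagram G N ` S"
  \<comment> \<open>The set \<open>S\<close> of assignments may be infinite, but its diagrams are
    finitely many, so the disjunction over them is a formula.\<close>
  have "?D \<subseteq> Pow ({..<N} \<times> {..<N}) \<times> Pow ({..<N} \<times> {..<N})"
    by (auto simp: diagram_def)
  then have fin: "finite ?D" by (rule finite_subset) auto
  have "\<forall>d. \<exists>\<Psi>. qfree \<Psi> \<and> free_vars \<Psi> \<subseteq> {..<N} \<and>
    (\<forall>(G :: 'a pair_pre_digraph) s. sat G s \<Psi> \<longleftrightarrow>
      (\<forall>i < N. \<forall>j < N. (s i = s j \<longleftrightarrow> (i, j) \<in> fst d) \<and> ((s i, s j) \<in> parcs G \<longleftrightarrow> (i, j) \<in> snd d)))"
    using ex_diagram_formula[OF assms, where ?'a = 'a] by blast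
  then obtain F where "\<forall>d. qfree (F d) \<and> free_vars (F d) \<subseteq> {..<N} \<and>
    (\<forall>(G :: 'a pair_pre_digraph) s. sat G s (F d) \<longleftrightarrow>
      (\<forall>i < N. \<forall>j < N. (s i = s j \<longleftrightarrow> (i, j) \<in> fst d) \<and> ((s i, s j) \<in> parcs G \<longleftrightarrow> (i, j) \<in> snd d)))"
    by (rule choice[THEN exE])
  then have F: "\<And>d. qfree (F d)" "\<And>d. free_vars (F d) \<subseteq> {..<N}"
    "\<And>d (G :: 'a pair_pre_digraph) s. sat G s (F d) \<longleftrightarrow>
      (\<forall>i < N. \<forall>j < N. (s i = s j \<longleftrightarrow> (i, j) \<in> fst d) \<and> ((s i, s j) \<in> parcs G \<longleftrightarrow> (i, j) \<in> snd d))"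
    by blast+
  have "sat H t (F (diagram G N s)) \<longleftrightarrow> diagram H N t = diagram G N s"
    for H :: "'a pair_pre_digraph" and t s
    unfolding F(3) diagram_eq_iff by (auto simp: diagram_def)
  then show ?thesis
    using ex_qfree_disj[OF fin assms, of F, where ?'a = 'a] F(1,2) by auto
qed

text \<open>The matrix lists every diagram that occurs in \<open>G\<close> when the existential
  variables enumerate \<open>A\<close>. If it holds on \<open>H\<close> with witnesses
  \<open>t\<close>, let \<open>f\<close> carry the enumeration of \<open>A\<close> to
  \<open>t\<close>; each set \<open>R\<close> of at most \<open>r\<close> vertices, read into the
  universal variables, has a diagram from the list, and this yields the map back into
  \<open>G\<close>.\<close>

lemma determined_by_imp_identifies:
  assumes G: "pair_graph G" and A: "A \<subseteq> pverts G" and pos: "card A + r > 0"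
    and det: "determined_by G r A"
  shows "\<exists>\<phi>. bs_formula (card A) r \<phi> \<and> identifies \<phi> G"
proof -
  define p where "p = card A"
  define N where "N = p + r"
  have "finite A" using G A by (auto simp: pair_graph_iff intro: finite_subset)
  then obtain a where a: "bij_betw a {..<p} A"
    unfolding p_def by (metis atLeast0LessThan ex_bij_betw_nat_finite)
  \<comment> \<open>Values at indices from \<open>N\<close> on are left free, since
    \<open>diagram G N\<close> does not see them.\<close>
  define S where "S = {s. (\<forall>i < p. s i = a i) \<and> (\<forall>i \<in> {p..<N}. s i \<in> pverts G)}"
  obtain \<Psi> where \<Psi>: "qfree \<Psi>" "free_vars \<Psi> \<subseteq> {..<N}"
    "\<And>(H :: 'a pair_pre_digraph) t. sat H t \<Psi> \<longleftrightarrow> (\<exists>s \<in> S. diagram H N t = diagram G N s)"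
    using ex_diagrams_formula[of N S G] pos unfolding N_def p_def by blast
  define \<phi> where "\<phi> = foldr FEx [0..<p] (foldr FAll [p..<N] \<Psi>)"
  have "closed_formula \<phi>"
    using \<Psi>(2) by (auto simp: closed_formula_def \<phi>_def)
  moreover have "bs_formula p r \<phi>"
    unfolding bs_formula_def \<phi>_def
    by (rule exI[of _ "[0..<p]"], rule exI[of _ "[p..<N]"], rule exI[of _ \<Psi>])
      (use \<Psi>(1) in \<open>auto simp: N_def\<close>)
  moreover have "true_on \<phi> G"
    unfolding true_on_def \<phi>_def sat_foldr_FEx sat_foldr_FAll
  proof
    fix s
    let ?t = "\<lambda>i. if i < p then a i else s i"
    have "\<forall>u. (\<forall>i \<in> set [p..<N]. u i \<in> pverts G) \<and> (\<forall>i. i \<notin> set [p..<N] \<longrightarrow> u i = ?t i) \<longrightarrow> u \<in> S"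
      by (auto simp: S_def)
    then show "\<exists>t. (\<forall>i \<in> set [0..<p]. t i \<in> pverts G) \<and> (\<forall>i. i \<notin> set [0..<p] \<longrightarrow> t i = s i) \<and>
        (\<forall>u. (\<forall>i \<in> set [p..<N]. u i \<in> pverts G) \<and> (\<forall>i. i \<notin> set [p..<N] \<longrightarrow> u i = t i) \<longrightarrow> sat G u \<Psi>)"
      using a A by (intro exI[of _ ?t]) (auto simp: \<Psi>(3) bij_betw_def)
  qed
  moreover have "graph_iso G H"
    if H: "pair_graph H" "order H = order G" and tr: "true_on \<phi> H" for H :: "'a pair_pre_digraph"
  proof -
    from tr obtain t where tV: "\<And>i. i < p \<Longrightarrow> t i \<in> pverts H"
      and t: "\<And>u. (\<forall>i \<in> {p..<N}. u i \<in> pverts H) \<Longrightarrow> (\<forall>i. i \<notin> {p..<N} \<longrightarrow> u i = t i) \<Longrightarrow> sat H u \<Psi>"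
      unfolding true_on_def \<phi>_def sat_foldr_FEx sat_foldr_FAll set_upt
      by (metis atLeastLessThan_iff le0)
    define f where "f x = t (the_inv_into {..<p} a x)" for x
    have fa: "f (a i) = t i" if "i < p" for i
      using a that by (simp add: f_def the_inv_into_f_f bij_betw_def)
    have Aim: "A = a ` {..<p}" using a by (simp add: bij_betw_def)
    have fA: "f ` A = t ` {..<p}" unfolding Aim image_image using fa by auto
    have "back_embeds r A f G H"
      unfolding back_embeds_def
    proof (intro conjI allI impI)
      show "f ` A \<subseteq> pverts H" using tV by (auto simp: fA)
      fix R assume R: "R \<subseteq> pverts H" "card R \<le> r"
      let ?g = "\<lambda>g. inj_on g (f ` A \<union> R) \<and> g ` (f ` A \<union> R) \<subseteq> pverts G \<and> (\<forall>a \<in> A. g (f a) = a) \<and>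
        (\<forall>u \<in> f ` A \<union> R. \<forall>v \<in> f ` A \<union> R. (u, v) \<in> parcs H \<longleftrightarrow> (g u, g v) \<in> parcs G)"
      show "\<exists>g. ?g g"
      proof (cases "f ` A \<union> R = {}")
        case True
        then show ?thesis by auto
      next
        case False
        then obtain w where w: "w \<in> f ` A \<union> R" by blast
        have "finite R" using R H by (auto simp: pair_graph_iff intro: finite_subset)
        then obtain e where e: "bij_betw e {..<card R} R"
          by (metis atLeast0LessThan ex_bij_betw_nat_finite)
        \<comment> \<open>The first \<open>N\<close> values of \<open>u\<close> exhaust the copy of
          \<open>A\<close> together with \<open>R\<close>; universal variables left over after
          \<open>R\<close> is enumerated repeat the vertex \<open>w\<close>, which is why the empty
          case was split off.\<close>
        define u where "u i = (if i \<in> {p..<N} then if i - p < card R then e (i - p) else w else t i)" for i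
        have ut: "\<And>i. i < p \<Longrightarrow> u i = t i" by (simp add: u_def)
        have im: "u ` {..<N} = f ` A \<union> R"
        proof
          show "u ` {..<N} \<subseteq> f ` A \<union> R"
            using w e unfolding fA u_def bij_betw_def by (auto split: if_splits)
          have "f ` A \<subseteq> u ` {..<N}" unfolding fA by (auto simp: N_def ut[symmetric])
          moreover have "R \<subseteq> u ` {..<N}"
          proof
            fix x assume "x \<in> R"
            then obtain i where "i < card R" "x = e i" using e by (auto simp: bij_betw_def)
            then have "p + i < N" "u (p + i) = x" using R by (auto simp: u_def N_def)
            then show "x \<in> u ` {..<N}" by blast
          qed
          ultimately show "f ` A \<union> R \<subseteq> u ` {..<N}" by blast
        qed
        have sub: "f ` A \<union> R \<subseteq> pverts H" using tV R by (auto simp: fA)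
        have "sat H u \<Psi>"
        proof (rule t)
          have "u i \<in> pverts H" if "i < N" for i
            using im sub that by (metis imageI lessThan_iff subsetD)
          then show "\<forall>i \<in> {p..<N}. u i \<in> pverts H" by simp
        qed (simp add: u_def)
        then obtain s where s: "s \<in> S" and d: "diagram H N u = diagram G N s"
          using \<Psi>(3) by blast
        \<comment> \<open>The choice of the index is immaterial: by equality of diagrams
          \<open>s\<close> identifies exactly the indices that \<open>u\<close> identifies. The same
          fact makes \<open>g\<close> injective.\<close>
        define g where "g x = s (SOME i. i < N \<and> u i = x)" for x
        have gu: "g (u i) = s i" if "i < N" for i
        proof -
          have "(SOME j. j < N \<and> u j = u i) < N \<and> u (SOME j. j < N \<and> u j = u i) = u i"
            by (rule someI[of _ i]) (use that in auto)
          then show ?thesis using d that unfolding g_def diagram_eq_iff by metis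
        qed
        have sV: "s i \<in> pverts G" if "i < N" for i
          using s that A a unfolding S_def bij_betw_def
          by (cases "i < p") auto
        have "?g g"
          unfolding im[symmetric]
        proof (intro conjI)
          show "inj_on g (u ` {..<N})"
            using d by (auto simp: inj_on_def gu diagram_eq_iff)
          show "g ` u ` {..<N} \<subseteq> pverts G"
            using sV by (auto simp: gu)
          show "\<forall>x \<in> A. g (f x) = x"
          proof
            fix x assume "x \<in> A"
            then obtain i where i: "i < p" "x = a i" unfolding Aim by blast
            then have "g (f x) = s i" using gu[of i] fa ut by (simp add: N_def)
            then show "g (f x) = x" using i s by (simp add: S_def)
          qed
          show "\<forall>x \<in> u ` {..<N}. \<forall>y \<in> u ` {..<N}. (x, y) \<in> parcs H \<longleftrightarrow> (g x, g y) \<in> parcs G"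
            using d by (auto simp: gu diagram_eq_iff)
        qed
        then show ?thesis by blast
      qed
    qed
    then show ?thesis using det H unfolding determined_by_def by blast
  qed
  ultimately show ?thesis
    unfolding identifies_def p_def by blast
qed

text \<open>The direction needed for lower bounds. \<open>A\<close> collects the witnesses in
  \<open>G\<close>, which may coincide, hence only \<open>card A \<le> p\<close>. Every choice of
  the universal variables in \<open>H\<close> is pulled back to \<open>G\<close> by a partial
  embedding, and the quantifier-free matrix cannot tell the two assignments apart.\<close>

lemma identifies_imp_determined_by:
  assumes bs: "bs_formula p r \<phi>" and id: "identifies \<phi> G"
  shows "\<exists>A \<subseteq> pverts G. card A \<le> p \<and> determined_by G r A"
proof -
  obtain ys xs \<Psi> where \<phi>: "\<phi> = foldr FEx ys (foldr FAll xs \<Psi>)"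
    and len: "length ys = p" "length xs = r" and dist: "distinct (ys @ xs)" and qf: "qfree \<Psi>"
    using bs unfolding bs_formula_def by blast
  have fv: "free_vars \<Psi> \<subseteq> set ys \<union> set xs"
    using id unfolding identifies_def closed_formula_def \<phi> by auto
  have "sat G (\<lambda>_. undefined) \<phi>"
    using id unfolding identifies_def true_on_def by blast
  then obtain t where tV: "\<forall>i \<in> set ys. t i \<in> pverts G"
    and t: "\<forall>u. (\<forall>i \<in> set xs. u i \<in> pverts G) \<and> (\<forall>i. i \<notin> set xs \<longrightarrow> u i = t i) \<longrightarrow> sat G u \<Psi>"
    unfolding \<phi> sat_foldr_FEx sat_foldr_FAll by (elim exE conjE) (rule that)
  define A where "A = t ` set ys"
  have "card A \<le> p" using card_length[of "map t ys"] len by (simp add: A_def)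
  moreover have "A \<subseteq> pverts G" using tV by (auto simp: A_def)
  moreover have "determined_by G r A"
    unfolding determined_by_def
  proof (intro allI impI)
    fix H :: "'a pair_pre_digraph"
    assume H: "pair_graph H \<and> order H = order G \<and> (\<exists>f. back_embeds r A f G H)"
    then obtain f where f: "back_embeds r A f G H" by blast
    have "sat H s \<phi>" for s
    proof -
      \<comment> \<open>The witnesses in \<open>H\<close> are the images under \<open>f\<close> of
        the witnesses in \<open>G\<close>.\<close>
      let ?v = "\<lambda>i. if i \<in> set ys then f (t i) else s i"
      have "sat H u \<Psi>"
        if u: "\<forall>i \<in> set xs. u i \<in> pverts H" "\<forall>i. i \<notin> set xs \<longrightarrow> u i = ?v i" for u
      proof -
        have "card (u ` set xs) \<le> r"
          using card_length[of "map u xs"] len by simp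
        moreover have "u ` set xs \<subseteq> pverts H" using u by auto
        ultimately obtain g where g: "inj_on g (f ` A \<union> u ` set xs)"
          "g ` (f ` A \<union> u ` set xs) \<subseteq> pverts G" "\<forall>a \<in> A. g (f a) = a"
          "\<forall>x \<in> f ` A \<union> u ` set xs. \<forall>y \<in> f ` A \<union> u ` set xs. (x, y) \<in> parcs H \<longleftrightarrow> (g x, g y) \<in> parcs G"
          using back_embedsE[OF f] by metis
        have uy: "u i = f (t i)" if "i \<in> set ys" for i
          using u(2) that dist by auto
        let ?s = "\<lambda>i. if i \<in> set xs then g (u i) else t i"
        have "sat G ?s \<Psi>"
          using g(2) by (intro t[rule_format]) auto
        moreover have s: "?s i = g (u i)" if "i \<in> set ys \<union> set xs" for i
          using that uy g(3) by (auto simp: A_def)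
        moreover have uin: "u i \<in> f ` A \<union> u ` set xs" if "i \<in> set ys \<union> set xs" for i
          using that uy by (auto simp: A_def)
        have "sat H u \<Psi> \<longleftrightarrow> sat G ?s \<Psi>"
        proof (rule sat_qfree_cong[OF qf])
          fix i j assume "i \<in> free_vars \<Psi>" "j \<in> free_vars \<Psi>"
          then have ij: "i \<in> set ys \<union> set xs" "j \<in> set ys \<union> set xs" using fv by auto
          show "(u i = u j \<longleftrightarrow> ?s i = ?s j) \<and> ((u i, u j) \<in> parcs H \<longleftrightarrow> (?s i, ?s j) \<in> parcs G)"
            unfolding s[OF ij(1)] s[OF ij(2)]
            using uin[OF ij(1)] uin[OF ij(2)] g(1,4) by (auto dest: inj_onD)
        qed
        ultimately show ?thesis by blast
      qed
      moreover have "\<forall>i \<in> set ys. ?v i \<in> pverts H"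
        using f by (auto simp: back_embeds_def A_def)
      ultimately show ?thesis
        unfolding \<phi> sat_foldr_FEx sat_foldr_FAll by (intro exI[of _ ?v]) simp
    qed
    then have "true_on \<phi> H" by (simp add: true_on_def)
    then show "graph_iso G H" using id H unfolding identifies_def by blast
  qed
  ultimately show ?thesis by blast
qed

section \<open>Twins\<close>

definition ntype :: "'a pair_pre_digraph \<Rightarrow> 'a set \<Rightarrow> 'a \<Rightarrow> 'a set" where
  "ntype G A v = {a \<in> A. (v, a) \<in> parcs G}"

text \<open>Adjacency between \<open>u\<close> and \<open>v\<close> themselves is left out, so
  adjacent and non-adjacent twins are both covered. For two vertices of a graph this says that their
  transposition is an automorphism.\<close>

definition twins :: "'a pair_pre_digraph \<Rightarrow> 'a \<Rightarrow> 'a \<Rightarrow> bool" where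
  "twins G u v \<longleftrightarrow> ntype G (pverts G - {u, v}) u = ntype G (pverts G - {u, v}) v"

definition twin_base :: "'a pair_pre_digraph \<Rightarrow> 'a set \<Rightarrow> bool" where
  "twin_base G A \<longleftrightarrow> A \<subseteq> pverts G \<and>
    (\<forall>u \<in> pverts G - A. \<forall>v \<in> pverts G - A. ntype G A u = ntype G A v \<longrightarrow> twins G u v)"

lemma ntype_eq_iff: "ntype G A u = ntype G A v \<longleftrightarrow> (\<forall>a \<in> A. (u, a) \<in> parcs G \<longleftrightarrow> (v, a) \<in> parcs G)"
  by (auto simp: ntype_def)

lemma twins_iff:
  "twins G u v \<longleftrightarrow> (\<forall>w \<in> pverts G - {u, v}. (u, w) \<in> parcs G \<longleftrightarrow> (v, w) \<in> parcs G)"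
  by (simp add: twins_def ntype_eq_iff)

lemma twins_refl: "twins G u u"
  by (simp add: twins_def)

section \<open>Counting classes and the sufficient criterion\<close>

lemma sum_card_fibres:
  assumes "finite S" "finite T" "t ` S \<subseteq> T"
  shows "(\<Sum>\<tau> \<in> T. card {x \<in> S. t x = \<tau>}) = card S"
  using sum.group[OF assms, of "\<lambda>_. 1 :: nat"] by simp

text \<open>Bijections chosen separately between corresponding fibres glue together, as distinct
  fibres are disjoint.\<close>

lemma ex_bij_betw_fibres:
  assumes "finite A" "finite B" "\<And>\<tau>. card {a \<in> A. s a = \<tau>} = card {b \<in> B. t b = \<tau>}"
  shows "\<exists>h. bij_betw h A B \<and> (\<forall>a \<in> A. t (h a) = s a)"
proof -
  have "\<forall>\<tau>. \<exists>k. bij_betw k {a \<in> A. s a = \<tau>} {b \<in> B. t b = \<tau>}"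
    using assms by (auto intro!: finite_same_card_bij)
  then obtain k where k: "\<And>\<tau>. bij_betw (k \<tau>) {a \<in> A. s a = \<tau>} {b \<in> B. t b = \<tau>}"
    by metis
  define h where "h a = k (s a) a" for a
  have h: "h a \<in> B \<and> t (h a) = s a" if "a \<in> A" for a
    using k[of "s a"] that unfolding h_def bij_betw_def by blast
  have "inj_on h A"
  proof (rule inj_onI)
    fix x y assume xy: "x \<in> A" "y \<in> A" "h x = h y"
    then have "s x = s y" using h by metis
    with xy show "x = y"
      using k[of "s x"] unfolding h_def bij_betw_def inj_on_def by auto
  qed
  moreover have "B \<subseteq> h ` A"
  proof
    fix b assume "b \<in> B"
    then have "b \<in> k (t b) ` {a \<in> A. s a = t b}"
      using k[of "t b"] unfolding bij_betw_def by blast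
    then obtain a where "a \<in> A" "s a = t b" "b = k (t b) a" by blast
    then have "b = h a" by (simp add: h_def)
    with \<open>a \<in> A\<close> show "b \<in> h ` A" by blast
  qed
  ultimately show ?thesis using h by (intro exI[of _ h]) (auto simp: bij_betw_def)
qed

text \<open>Exchange \<open>u\<close> for its twin \<open>v\<close>, then \<open>u'\<close> for its
  twin \<open>v'\<close>. Hence outside a twin base the adjacency of two distinct vertices depends
  on their types alone.\<close>

lemma twin_base_adj_eq:
  assumes G: "pair_graph G" and A: "twin_base G A"
    and V: "u \<in> pverts G - A" "u' \<in> pverts G - A" "v \<in> pverts G - A" "v' \<in> pverts G - A"
    and ty: "ntype G A u = ntype G A v" "ntype G A u' = ntype G A v'"
    and ne: "u \<noteq> u'" "v \<noteq> v'"
  shows "(u, u') \<in> parcs G \<longleftrightarrow> (v, v') \<in> parcs G"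
proof -
  have sy: "\<And>x y. (x, y) \<in> parcs G \<longleftrightarrow> (y, x) \<in> parcs G" using G by (auto simp: pair_graph_iff)
  have tw: "(x, z) \<in> parcs G \<longleftrightarrow> (y, z) \<in> parcs G"
    if "x \<in> pverts G - A" "y \<in> pverts G - A" "ntype G A x = ntype G A y" "z \<in> pverts G" "z \<noteq> x" "z \<noteq> y"
    for x y z
    using A that unfolding twin_base_def twins_iff by blast
  show ?thesis
  proof (cases "v = u'")
    case False
    have "(u, u') \<in> parcs G \<longleftrightarrow> (v, u') \<in> parcs G"
      using tw[of u v u'] V ty ne False by auto
    also have "\<dots> \<longleftrightarrow> (v, v') \<in> parcs G"
      using tw[of u' v' v] V ty ne False sy by auto
    finally show ?thesis .
  next
    \<comment> \<open>Now \<open>u\<close>, \<open>u' = v\<close> and \<open>v'\<close> all have the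
      same type, and the single exchange of \<open>u\<close> for \<open>v'\<close> suffices.\<close>
    case True
    then show ?thesis
      using tw[of u v' u'] V ty ne sy by (cases "u = v'") auto
  qed
qed

text \<open>Single vertices of \<open>H\<close> show that only types from \<open>G\<close> occur;
  sets of at most \<open>r\<close> vertices show that no class of \<open>H\<close> is larger than
  its counterpart in \<open>G\<close>, and the equal totals then force equal sizes. A
  type-preserving bijection is an isomorphism, because pairs in \<open>H\<close> look like pairs in
  \<open>G\<close> and adjacency outside \<open>A\<close> depends on types only.\<close>

lemma twin_base_determined_by:
  assumes G: "pair_graph G" and A: "twin_base G A" and r: "r \<ge> 2"
    and sizes: "(\<forall>u \<in> pverts G - A. \<forall>v \<in> pverts G - A. ntype G A u = ntype G A v) \<or>
      (\<forall>v \<in> pverts G - A. card {u \<in> pverts G - A. ntype G A u = ntype G A v} < r)"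
  shows "determined_by G r A"
  unfolding determined_by_def
proof (intro allI impI, elim conjE exE)
  fix H :: "'a pair_pre_digraph" and f
  assume H: "pair_graph H" and ord: "order H = order G" and f: "back_embeds r A f G H"
  let ?B = "pverts G - A" and ?C = "pverts H - f ` A"
  define tH where "tH w = {a \<in> A. (w, f a) \<in> parcs H}" for w
  have fin: "finite (pverts G)" "finite (pverts H)" using G H by (auto simp: pair_graph_iff)
  have AV: "A \<subseteq> pverts G" using A by (simp add: twin_base_def)
  have fA: "f ` A \<subseteq> pverts H" using f by (simp add: back_embeds_def)
  have sy: "\<And>x y. (x, y) \<in> parcs G \<longleftrightarrow> (y, x) \<in> parcs G" "\<And>x y. (x, y) \<in> parcs H \<longleftrightarrow> (y, x) \<in> parcs H"
    using G H by (auto simp: pair_graph_iff)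
  have emb: "\<exists>g. inj_on g R \<and> g ` R \<subseteq> ?B \<and> (\<forall>w \<in> R. ntype G A (g w) = tH w) \<and>
      (\<forall>u \<in> R. \<forall>v \<in> R. (u, v) \<in> parcs H \<longleftrightarrow> (g u, g v) \<in> parcs G)"
    if R: "R \<subseteq> ?C" "card R \<le> r" for R
  proof -
    obtain g where g: "inj_on g (f ` A \<union> R)" "g ` (f ` A \<union> R) \<subseteq> pverts G" "\<forall>a \<in> A. g (f a) = a"
      "\<forall>u \<in> f ` A \<union> R. \<forall>v \<in> f ` A \<union> R. (u, v) \<in> parcs H \<longleftrightarrow> (g u, g v) \<in> parcs G"
      using back_embedsE[OF f, of R] R by blast
    \<comment> \<open>On the copy of \<open>A\<close>, \<open>g\<close> already takes all values in
      \<open>A\<close>; injectivity keeps the remaining vertices outside \<open>A\<close>.\<close>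
    have "g w \<notin> A" if w: "w \<in> R" for w
    proof
      assume a: "g w \<in> A"
      then have "g w = g (f (g w))" using g(3) by simp
      then have "w = f (g w)" using g(1) w a by (auto dest: inj_onD)
      then show False using R w a by blast
    qed
    moreover have "ntype G A (g w) = tH w" if w: "w \<in> R" for w
      unfolding ntype_def tH_def using g(3,4) w by fastforce
    ultimately show ?thesis
      using g by (intro exI[of _ g]) (auto simp: inj_on_def)
  qed
  have injf: "inj_on f A"
  proof -
    obtain g where "\<forall>a \<in> A. g (f a) = a"
      by (rule back_embedsE[OF f, of "{}"]) auto
    then show ?thesis by (metis inj_onI)
  qed
  have cardBC: "card ?C = card ?B"
    using ord fin AV fA injf
    by (simp add: card_Diff_subset card_image order_def finite_subset)
  have tyC: "\<exists>v \<in> ?B. ntype G A v = tH w" if "w \<in> ?C" for w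
    using emb[of "{w}"] that r by auto
  let ?b = "\<lambda>\<tau>. card {v \<in> ?B. ntype G A v = \<tau>}" and ?c = "\<lambda>\<tau>. card {w \<in> ?C. tH w = \<tau>}"
  have "?c \<tau> = ?b \<tau>" for \<tau>
  proof (rule disjE[OF sizes])
    assume one: "\<forall>u \<in> ?B. \<forall>v \<in> ?B. ntype G A u = ntype G A v"
    show ?thesis
    proof (cases "\<exists>v \<in> ?B. ntype G A v = \<tau>")
      case True
      then have all: "ntype G A v = \<tau>" if "v \<in> ?B" for v using one that by metis
      then have "tH w = \<tau>" if "w \<in> ?C" for w using tyC[OF that] by metis
      then have "{v \<in> ?B. ntype G A v = \<tau>} = ?B" "{w \<in> ?C. tH w = \<tau>} = ?C"
        using all by blast+
      then show ?thesis using cardBC by simp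
    next
      case False
      then have "{v \<in> ?B. ntype G A v = \<tau>} = {}" "{w \<in> ?C. tH w = \<tau>} = {}"
        using tyC by blast+
      then show ?thesis by (simp only: card.empty)
    qed
  next
    assume small: "\<forall>v \<in> ?B. card {u \<in> ?B. ntype G A u = ntype G A v} < r"
    \<comment> \<open>One vertex more than the class has in \<open>G\<close> is still at most
      \<open>r\<close> vertices, so an excess in \<open>H\<close> would embed into a class that is
      too small for it.\<close>
    have le: "?c \<tau> \<le> ?b \<tau>" for \<tau>
    proof (rule ccontr)
      assume less: "\<not> ?c \<tau> \<le> ?b \<tau>"
      then have "Suc (?b \<tau>) \<le> ?c \<tau>" by linarith
      then obtain R where R: "R \<subseteq> {w \<in> ?C. tH w = \<tau>}" "card R = Suc (?b \<tau>)"
        by (rule obtain_subset_with_card_n)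
      then obtain w where "w \<in> R" by fastforce
      then obtain v where v: "v \<in> ?B" "ntype G A v = \<tau>" using R(1) tyC[of w] by blast
      have "?b \<tau> < r" using bspec[OF small v(1)] by (simp only: v(2))
      then have Rr: "card R \<le> r" using R(2) by simp
      have RC: "R \<subseteq> ?C" using R(1) by blast
      from emb[OF RC Rr] obtain g where g: "inj_on g R" "g ` R \<subseteq> ?B" "\<forall>w \<in> R. ntype G A (g w) = tH w"
        by (elim exE conjE) (rule that)
      then have "g ` R \<subseteq> {v \<in> ?B. ntype G A v = \<tau>}" using R(1) by auto
      then have "card R \<le> ?b \<tau>"
        using card_mono[of "{v \<in> ?B. ntype G A v = \<tau>}" "g ` R"] card_image[OF g(1)] fin by simp
      then show False using R(2) by simp
    qed
    let ?T = "ntype G A ` ?B"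
    have finT: "finite ?T" using fin by simp
    have "tH w \<in> ?T" if "w \<in> ?C" for w using tyC[OF that] by (metis imageI)
    then have "tH ` ?C \<subseteq> ?T" by blast
    then have "sum ?c ?T = card ?C"
      using fin finT by (intro sum_card_fibres) auto
    moreover have "sum ?b ?T = card ?B"
      using fin finT by (intro sum_card_fibres) auto
    ultimately have "sum ?c ?T = sum ?b ?T" using cardBC by simp
    \<comment> \<open>Termwise inequality together with equal sums over the types of
      \<open>G\<close> gives termwise equality.\<close>
    then have eq: "?c \<tau> = ?b \<tau>" if "\<tau> \<in> ?T" for \<tau>
      using sum_mono_inv[of ?c ?T ?b \<tau>] le that finT by blast
    show ?thesis
    proof (cases "\<tau> \<in> ?T")
      case False
      then have "{v \<in> ?B. ntype G A v = \<tau>} = {}" by auto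
      then have "?b \<tau> = 0" by (simp only: card.empty)
      then show ?thesis using le[of \<tau>] by simp
    qed (rule eq)
  qed
  then obtain h where h: "bij_betw h ?C ?B" and ht: "\<And>w. w \<in> ?C \<Longrightarrow> ntype G A (h w) = tH w"
    using ex_bij_betw_fibres[of ?C ?B tH "ntype G A"] fin by auto
  define k where "k w = (if w \<in> f ` A then the_inv_into A f w else h w)" for w
  have kf: "k (f a) = a" if "a \<in> A" for a
    using that injf by (simp add: k_def the_inv_into_f_f)
  have kh: "k w = h w" if "w \<in> ?C" for w using that by (simp add: k_def)
  have "bij_betw k (f ` A \<union> ?C) (A \<union> ?B)"
  proof (rule bij_betw_combine)
    show "bij_betw k (f ` A) A"
      using injf kf by (auto simp: bij_betw_def inj_on_def image_iff)
    show "bij_betw k ?C ?B" using h kh by (metis (no_types, lifting) bij_betw_cong)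
  qed auto
  then have bij: "bij_betw k (pverts H) (pverts G)"
    using AV fA by (simp add: Un_absorb1)
  have adjA: "(w, f a) \<in> parcs H \<longleftrightarrow> (k w, a) \<in> parcs G" if wa: "w \<in> pverts H" "a \<in> A" for w a
  proof (cases "w \<in> ?C")
    case True
    then show ?thesis
      using ht[OF True] kh[OF True] wa by (auto simp: tH_def ntype_def)
  next
    case False
    then obtain b where b: "b \<in> A" "w = f b" using wa by blast
    obtain g where "\<forall>a \<in> A. g (f a) = a" "\<forall>u \<in> f ` A. \<forall>v \<in> f ` A. (u, v) \<in> parcs H \<longleftrightarrow> (g u, g v) \<in> parcs G"
      by (rule back_embedsE[OF f, of "{}"]) auto
    then show ?thesis using b wa kf by simp
  qed
  have "(u, v) \<in> parcs H \<longleftrightarrow> (k u, k v) \<in> parcs G" if uv: "u \<in> pverts H" "v \<in> pverts H" for u v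
  proof -
    consider "v \<in> f ` A" | "u \<in> f ` A" | "u = v" | "u \<in> ?C" "v \<in> ?C" "u \<noteq> v" using uv by blast
    then show ?thesis
    proof cases
      case 1
      then show ?thesis using adjA[OF uv(1)] kf by auto
    next
      case 2
      then show ?thesis using adjA[OF uv(2)] kf sy by auto
    next
      case 3
      then show ?thesis using G H by (simp add: pair_graph_iff)
    next
      case 4
      then have uvC: "{u, v} \<subseteq> ?C" "card {u, v} \<le> r" using r by auto
      from emb[OF uvC] obtain g where g: "inj_on g {u, v}" "g ` {u, v} \<subseteq> ?B" "\<forall>w \<in> {u, v}. ntype G A (g w) = tH w"
        "\<forall>x \<in> {u, v}. \<forall>y \<in> {u, v}. (x, y) \<in> parcs H \<longleftrightarrow> (g x, g y) \<in> parcs G"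
        by (elim exE conjE) (rule that)
      have hB: "h u \<in> ?B" "h v \<in> ?B" "h u \<noteq> h v"
        using h 4 by (auto simp: bij_betw_def dest: inj_onD)
      \<comment> \<open>The two pairs have the same types over \<open>A\<close>, although
        \<open>g\<close> depends on \<open>u\<close> and \<open>v\<close> while \<open>h\<close> is
        global.\<close>
      have "(g u, g v) \<in> parcs G \<longleftrightarrow> (h u, h v) \<in> parcs G"
        using g 4 hB ht by (intro twin_base_adj_eq[OF G A]) auto
      then show ?thesis using g(4) 4 kh by simp
    qed
  qed
  then have "graph_iso H G" using bij graph_iso_iff[OF H G] by blast
  moreover interpret H: pair_graph H by fact
  have "wf_digraph (with_proj H)" by (rule H.wf_digraph_axioms)
  ultimately show "graph_iso G H" by (metis digraph_iso_swap)
qed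

text \<open>The fibre of \<open>z\<close> yields one value, and the elements outside it yield at
  most one value each.\<close>

lemma card_ge_card_image_add_fibre:
  assumes "finite Z" "z \<in> Z" "m \<le> card {u \<in> Z. t u = t z}" 
  shows "card (t ` Z) + m \<le> card Z + 1"
proof -
  let ?D = "{u \<in> Z. t u = t z}"
  have "t ` Z = insert (t z) (t ` (Z - ?D))" using assms by auto
  then have "card (t ` Z) \<le> Suc (card (Z - ?D))"
    using assms card_image_le[of "Z - ?D" t] by (simp add: card_insert_if)
  moreover have "card (Z - ?D) = card Z - card ?D" "card ?D \<le> card Z"
    using assms by (auto intro!: card_Diff_subset card_mono)
  ultimately show ?thesis using assms by linarith
qed

section \<open>The bound for BS\<close>

lemma ntype_mono_eq: "ntype G B u = ntype G B v \<Longrightarrow> A \<subseteq> B \<Longrightarrow> ntype G A u = ntype G A v"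
  by (auto simp: ntype_eq_iff)

lemma card_ntype_image_insert:
  assumes "finite W" "u \<in> W" "v \<in> W" "ntype G X u = ntype G X v"
    and "\<not> ((u, z) \<in> parcs G \<longleftrightarrow> (v, z) \<in> parcs G)"
  shows "card (ntype G X ` W) < card (ntype G (insert z X) ` W)"
proof -
  let ?T = "ntype G (insert z X) ` W" and ?\<pi> = "\<lambda>t. t \<inter> X"
  have \<pi>: "?\<pi> (ntype G (insert z X) w) = ntype G X w" for w by (auto simp: ntype_def)
  have "ntype G (insert z X) u \<noteq> ntype G (insert z X) v"
    using assms(5) by (auto simp: ntype_eq_iff)
  then have "\<not> inj_on ?\<pi> ?T"
    using assms(2-4) \<pi> by (metis imageI inj_onD)
  then have "card (?\<pi> ` ?T) < card ?T"
    using assms(1) by (metis card_image_le eq_card_imp_inj_on finite_imageI le_neq_implies_less)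
  then show ?thesis by (simp add: image_image \<pi>)
qed

lemma obtain_max_nat:
  fixes f :: "'b \<Rightarrow> nat"
  assumes "P a" "\<And>x. P x \<Longrightarrow> f x \<le> b"
  obtains x where "P x" "\<And>y. P y \<Longrightarrow> f y \<le> f x"
proof -
  have "\<forall>y. P y \<longrightarrow> f y < Suc b" using assms(2) by (simp add: less_Suc_eq_le)
  then show ?thesis using ex_has_greatest_nat[of P a f "Suc b"] assms(1) that by blast
qed

text \<open>\<open>X\<close> is a largest set with fewer elements than types outside it,
  \<open>Y\<close> consists of the singleton classes over \<open>X\<close>, and \<open>Z\<close> of
  the rest. A largest \<open>S \<subseteq> Y\<close> that adds at least \<open>card S\<close> types
  on \<open>Z\<close> completes the base \<open>A = X \<union> S\<close>. The inequality balances
  the types gained against the vertices spent.\<close>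

lemma ex_small_twin_base:
  assumes G: "pair_graph G" and ne: "pverts G \<noteq> {}"
  shows "\<exists>A v. twin_base G A \<and> v \<in> pverts G - A \<and>
    (\<forall>w \<in> pverts G - A. card {u \<in> pverts G - A. ntype G A u = ntype G A w} \<le>
      card {u \<in> pverts G - A. ntype G A u = ntype G A v}) \<and>
    3 * card A + 2 * card {u \<in> pverts G - A. ntype G A u = ntype G A v} \<le> 2 * card (pverts G)"
proof -
  let ?V = "pverts G"
  have fin: "finite ?V" using G by (simp add: pair_graph_iff)
  define P where "P X \<longleftrightarrow> X \<subseteq> ?V \<and> card X < card (ntype G X ` (?V - X))" for X
  have "ntype G {} ` ?V = {{}}" using ne by (auto simp: ntype_def)
  then have "P {}" by (simp add: P_def)
  moreover have "\<And>X. P X \<Longrightarrow> card X \<le> card ?V"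
    using fin by (auto simp: P_def intro: card_mono)
  ultimately obtain X where X: "P X" and Xmax: "\<And>X'. P X' \<Longrightarrow> card X' \<le> card X"
    using obtain_max_nat[of P "{}" card "card ?V"] by metis
  have XV: "X \<subseteq> ?V" and finX: "finite X" using X fin by (auto simp: P_def intro: finite_subset)
  define Y where "Y = {v \<in> ?V - X. \<forall>u \<in> ?V - X. ntype G X u = ntype G X v \<longrightarrow> u = v}"
  define Z where "Z = ?V - X - Y"
  have finYZ: "finite Y" "finite Z" using fin by (auto simp: Y_def Z_def)
  \<comment> \<open>Moving \<open>z\<close> into \<open>X\<close> loses no type, since another
    vertex shares the type of \<open>z\<close>. If \<open>z\<close> split a class, a type would be
    gained and \<open>insert z X\<close> would contradict the maximality of
    \<open>X\<close>.\<close>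
  have Zsplit: "(u, z) \<in> parcs G \<longleftrightarrow> (v, z) \<in> parcs G"
    if z: "z \<in> Z" and uv: "u \<in> ?V - X" "v \<in> ?V - X" "u \<noteq> z" "v \<noteq> z" "ntype G X u = ntype G X v" for z u v
  proof (rule ccontr)
    assume "\<not> ?thesis"
    then have lt: "card (ntype G X ` (?V - insert z X)) < card (ntype G (insert z X) ` (?V - insert z X))"
      using fin uv by (intro card_ntype_image_insert[of _ u v]) auto
    obtain z' where z': "z' \<in> ?V - X" "z' \<noteq> z" "ntype G X z' = ntype G X z"
      using z by (auto simp: Z_def Y_def)
    have "ntype G X ` (?V - X) = ntype G X ` (?V - insert z X)"
    proof
      show "ntype G X ` (?V - X) \<subseteq> ntype G X ` (?V - insert z X)"
      proof
        fix t assume "t \<in> ntype G X ` (?V - X)"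
        then obtain w where "w \<in> ?V - X" "t = ntype G X w" by blast
        then show "t \<in> ntype G X ` (?V - insert z X)"
          using z' by (cases "w = z") auto
      qed
    qed auto
    then have "P (insert z X)"
      using X lt z finX by (auto simp: P_def Z_def)
    then show False using Xmax z finX by (fastforce simp: Z_def)
  qed
  \<comment> \<open>Each vertex taken from \<open>Y\<close> has to be paid for by a new type on
    \<open>Z\<close>.\<close>
  define Q where "Q S \<longleftrightarrow> S \<subseteq> Y \<and> card (ntype G X ` Z) + card S \<le> card (ntype G (X \<union> S) ` Z)" for S
  have "Q {}" by (simp add: Q_def)
  moreover have "\<And>S. Q S \<Longrightarrow> card S \<le> card Y"
    using finYZ by (auto simp: Q_def intro: card_mono)
  ultimately obtain S where S: "Q S" and Smax: "\<And>S'. Q S' \<Longrightarrow> card S' \<le> card S"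
    using obtain_max_nat[of Q "{}" card "card Y"] by metis
  have SY: "S \<subseteq> Y" and finS: "finite S" using S finYZ by (auto simp: Q_def intro: finite_subset)
  define A where "A = X \<union> S"
  \<comment> \<open>A vertex of \<open>Y - S\<close> splitting a class on \<open>Z\<close> would pay
    for itself and could be added to \<open>S\<close>.\<close>
  have Ysplit: "(u, y) \<in> parcs G \<longleftrightarrow> (v, y) \<in> parcs G"
    if y: "y \<in> Y - S" and uv: "u \<in> Z" "v \<in> Z" "ntype G A u = ntype G A v" for y u v
  proof (rule ccontr)
    assume "\<not> ?thesis"
    then have "card (ntype G A ` Z) < card (ntype G (insert y A) ` Z)"
      using finYZ uv by (intro card_ntype_image_insert[of _ u v]) auto
    moreover have "insert y A = X \<union> insert y S" by (simp add: A_def)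
    ultimately have "Q (insert y S)"
      using S y finS by (simp add: Q_def A_def)
    then show False using Smax y finS by fastforce
  qed
  have AV: "A \<subseteq> ?V" using XV SY by (auto simp: A_def Y_def)
  have VA: "?V - A = (Y - S) \<union> Z" using XV SY by (auto simp: A_def Y_def Z_def)
  have tyX: "ntype G X u = ntype G X v" if "ntype G A u = ntype G A v" for u v
    using that by (rule ntype_mono_eq) (simp add: A_def)
  have Yuniq: "u = v" if "u \<in> ?V - A" "v \<in> ?V - A" "v \<in> Y" "ntype G A u = ntype G A v" for u v
    using that tyX[of u v] by (auto simp: Y_def A_def)
  have "twins G u v" if uv: "u \<in> ?V - A" "v \<in> ?V - A" "ntype G A u = ntype G A v" for u v
  proof (cases "u \<in> Y \<or> v \<in> Y")
    case True
    then have "u = v" using Yuniq uv by metis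
    then show ?thesis using twins_refl by simp
  next
    case False
    then have Z: "u \<in> Z" "v \<in> Z" using uv VA by auto
    show ?thesis
      unfolding twins_iff
    proof
      fix w assume w: "w \<in> ?V - {u, v}"
      \<comment> \<open>Three kinds of possible separators: vertices of \<open>A\<close> are
        excluded by equal types, the others because they split no class.\<close>
      consider "w \<in> A" | "w \<in> Y - S" | "w \<in> Z" using w VA by auto
      then show "(u, w) \<in> parcs G \<longleftrightarrow> (v, w) \<in> parcs G"
      proof cases
        case 1
        then show ?thesis using uv(3) by (simp add: ntype_eq_iff)
      next
        case 2
        then show ?thesis using Ysplit Z uv(3) by blast
      next
        case 3
        show ?thesis
        proof (rule Zsplit[OF 3])
          show "u \<in> ?V - X" "v \<in> ?V - X" using uv by (auto simp: A_def)
          show "u \<noteq> w" "v \<noteq> w" using w by auto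
        qed (rule tyX[OF uv(3)])
      qed
    qed
  qed
  then have base: "twin_base G A" using AV by (simp add: twin_base_def)
  define cls where "cls w = {u \<in> ?V - A. ntype G A u = ntype G A w}" for w
  define k where "k = card (ntype G X ` Z)"
  have Xk: "card X < card Y + k"
  proof -
    have "ntype G X ` (?V - X) = ntype G X ` Y \<union> ntype G X ` Z"
      by (auto simp: Z_def Y_def)
    then have "card (ntype G X ` (?V - X)) \<le> card Y + k"
      unfolding k_def using card_Un_le card_image_le[OF finYZ(1), of "ntype G X"]
      by (metis (no_types, lifting) add_le_mono1 order_trans)
    then show ?thesis using X by (simp add: P_def)
  qed
  have cV: "card ?V = card X + card Y + card Z"
  proof -
    have "?V = X \<union> Y \<union> Z" "X \<inter> Y = {}" "(X \<union> Y) \<inter> Z = {}" using XV by (auto simp: Y_def Z_def)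
    then show ?thesis using finX finYZ by (metis card_Un_disjoint finite_UnI)
  qed
  have SleY: "card S \<le> card Y" using SY finYZ by (simp add: card_mono)
  have kS: "k + card S \<le> card (ntype G A ` Z)" using S by (simp add: Q_def k_def A_def)
  have cA: "card A \<le> card X + card S" unfolding A_def by (rule card_Un_le)
  have Ycls: "cls w = {w}" if "w \<in> ?V - A" "w \<in> Y" for w
    using Yuniq that by (auto simp: cls_def)
  \<comment> \<open>This provides a class to maximise over. If nothing were left, \<open>Z\<close>
    would be empty, so \<open>k\<close> and \<open>card S\<close> would vanish while
    \<open>Y \<subseteq> S\<close>, contradicting \<open>Xk\<close>.\<close>
  have "?V - A \<noteq> {}"
  proof
    assume emp: "?V - A = {}"
    then have "Z = {}" "Y \<subseteq> S" using VA by auto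
    then show False using kS Xk SY by (auto simp: k_def)
  qed
  then obtain v\<^sub>0 where "v\<^sub>0 \<in> ?V - A" by blast
  moreover have "\<And>w. w \<in> ?V - A \<Longrightarrow> card (cls w) \<le> card ?V"
    using fin by (auto simp: cls_def intro!: card_mono)
  ultimately obtain v where v: "v \<in> ?V - A" and vmax: "\<And>w. w \<in> ?V - A \<Longrightarrow> card (cls w) \<le> card (cls v)"
    using obtain_max_nat[of "\<lambda>w. w \<in> ?V - A" v\<^sub>0 "\<lambda>w. card (cls w)" "card ?V"] by metis
  have "3 * card A + 2 * card (cls v) \<le> 2 * card ?V"
  proof (cases "Z = {}")
    case True
    \<comment> \<open>With \<open>Z\<close> empty all classes are singletons, and
      \<open>card X < card Y\<close> gives the inequality.\<close>
    then have "k = 0" "card S = 0" using kS by (auto simp: k_def)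
    moreover have "card (cls v) = 1" using True v VA Ycls[OF v] by auto
    ultimately show ?thesis using cA cV Xk by simp
  next
    case False
    \<comment> \<open>A largest class meeting \<open>Y\<close> is a singleton, so any class in the
      nonempty \<open>Z\<close> is at least as large.\<close>
    have "\<exists>z \<in> Z. card (cls v) \<le> card {u \<in> Z. ntype G A u = ntype G A z}"
    proof (cases "v \<in> Z")
      case True
      then have "cls v = {u \<in> Z. ntype G A u = ntype G A v}"
        using Yuniq v VA by (auto simp: cls_def Z_def)
      then show ?thesis using True by (intro bexI[of _ v]) simp_all
    next
      case nZ: False
      then have "card (cls v) = 1" using v VA Ycls[OF v] by auto
      moreover obtain z where z: "z \<in> Z" using False by blast
      moreover have "card {u \<in> Z. ntype G A u = ntype G A z} \<noteq> 0" using z finYZ by auto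
      ultimately show ?thesis by (intro bexI[of _ z]) linarith+
    qed
    then have "card (ntype G A ` Z) + card (cls v) \<le> card Z + 1"
      using card_ge_card_image_add_fibre[OF finYZ(2)] by blast
    moreover have "k \<noteq> 0" using False finYZ by (simp add: k_def)
    \<comment> \<open>With \<open>m\<close> the largest class size, this combines
      \<open>card X < card Y + k\<close>, \<open>k + card S + m \<le> card Z + 1\<close>,
      \<open>card S \<le> card Y\<close> and \<open>k \<ge> 1\<close>.\<close>
    ultimately show ?thesis using cA cV Xk SleY kS by linarith
  qed
  then show ?thesis
    using base v vmax unfolding cls_def by (intro exI[of _ A] exI[of _ v] conjI ballI)
qed

text \<open>Mutual twins have equal neighbours in the complement of \<open>D\<close>, so there is
  only one class and two universal variables suffice whatever the size of \<open>D\<close>.\<close>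

lemma twins_determined_by:
  assumes G: "pair_graph G" and D: "D \<subseteq> pverts G" and tw: "\<forall>x \<in> D. \<forall>y \<in> D. twins G x y"
  shows "determined_by G 2 (pverts G - D)"
proof (rule twin_base_determined_by[OF G])
  have V: "pverts G - (pverts G - D) = D" using D by auto
  show "twin_base G (pverts G - D)" unfolding twin_base_def V using tw by auto
  have "ntype G (pverts G - D) x = ntype G (pverts G - D) y" if "x \<in> D" "y \<in> D" for x y
    using bspec[OF bspec[OF tw that(1)] that(2)] unfolding twins_def
    by (rule ntype_mono_eq) (use that in blast)
  then show "(\<forall>u \<in> pverts G - (pverts G - D). \<forall>v \<in> pverts G - (pverts G - D).
      ntype G (pverts G - D) u = ntype G (pverts G - D) v) \<or>
    (\<forall>v \<in> pverts G - (pverts G - D). card {u \<in> pverts G - (pverts G - D).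
      ntype G (pverts G - D) u = ntype G (pverts G - D) v} < 2)"
    unfolding V by blast
qed simp

lemma BS_le:
  assumes "pair_graph G" "A \<subseteq> pverts G" "card A + r > 0" "determined_by G r A"
  shows "BS G \<le> enat (card A + r)" "r \<le> q \<Longrightarrow> BS_restr q G \<le> enat (card A + r)"
  using determined_by_imp_identifies[OF assms] unfolding BS_def BS_restr_def
  by (auto intro!: Inf_lower)

text \<open>Let \<open>m = card D\<close> be the largest class size. Taking \<open>A\<close> with
  \<open>r = m + 1\<close> costs at most \<open>(2 * n + m) / 3 + 1\<close>, and the complement of
  the class with \<open>r = 2\<close> costs \<open>n - m + 2\<close>. The first is good enough if
  \<open>4 * m \<le> n + 6\<close>, the second otherwise.\<close>

lemma BS_le_three_quarters:
  assumes G: "pair_graph G" and n: "order G = n"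
  shows "ereal_of_enat (BS G) \<le> ereal (3 * real n / 4 + 3 / 2)"
proof -
  have bound: ?thesis if "A \<subseteq> pverts G" "card A + r > 0" "determined_by G r A" "4 * (card A + r) \<le> 3 * n + 6" for A r
  proof -
    have "ereal_of_enat (BS G) \<le> ereal_of_enat (enat (card A + r))"
      using BS_le(1)[OF G that(1-3)] by (simp only: ereal_of_enat_le_iff)
    also have "\<dots> \<le> ereal (3 * real n / 4 + 3 / 2)"
    proof -
      have "4 * real (card A + r) \<le> 3 * real n + 6"
        using that(4) by (metis (mono_tags) of_nat_add of_nat_le_iff of_nat_mult of_nat_numeral)
      then show ?thesis by simp
    qed
    finally show ?thesis .
  qed
  show ?thesis
  proof (cases "n = 0")
    \<comment> \<open>The empty graph has no class to choose. Every atom mentions a variable, so one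
      universal variable is spent, which \<open>3 / 2\<close> allows.\<close>
    case True
    then have "finite (pverts G)" "card (pverts G) = 0" using G n by (auto simp: order_def pair_graph_iff)
    then have V: "pverts G = {}" by simp
    have "determined_by G 1 {}"
      unfolding determined_by_def
    proof (intro allI impI)
      fix H :: "'a pair_pre_digraph"
      assume H: "pair_graph H \<and> order H = order G \<and> (\<exists>f. back_embeds 1 {} f G H)"
      then have "finite (pverts H)" "card (pverts H) = 0" using True n by (auto simp: order_def pair_graph_iff)
      then have "pverts H = {}" by simp
      then show "graph_iso G H" using H V by (subst graph_iso_iff[OF G]) auto
    qed
    then show ?thesis using bound[of "{}" 1] by simp
  next
    case False
    then have "pverts G \<noteq> {}" using n by (auto simp: order_def)
    then obtain A v where A: "twin_base G A" and v: "v \<in> pverts G - A"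
      and vmax: "\<forall>w \<in> pverts G - A. card {u \<in> pverts G - A. ntype G A u = ntype G A w} \<le>
        card {u \<in> pverts G - A. ntype G A u = ntype G A v}"
      and small: "3 * card A + 2 * card {u \<in> pverts G - A. ntype G A u = ntype G A v} \<le> 2 * n"
      using ex_small_twin_base[OF G] n unfolding order_def by auto
    define D where "D = {u \<in> pverts G - A. ntype G A u = ntype G A v}"
    have finD: "finite D" and DV: "D \<subseteq> pverts G" and vD: "v \<in> D"
      using G v by (auto simp: D_def pair_graph_iff)
    have D1: "card D \<ge> 1" using finD vD by (metis One_nat_def Suc_leI card_gt_0_iff empty_iff)
    have AV: "A \<subseteq> pverts G" using A by (simp add: twin_base_def)
    show ?thesis
    proof (cases "4 * card D \<le> n + 6")
      case True
      have "determined_by G (card D + 1) A"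
        using D1 vmax by (intro twin_base_determined_by[OF G A]) (auto simp: D_def less_Suc_eq_le)
      then show ?thesis using AV small True bound[of A "card D + 1"] by (simp add: D_def)
    next
      case False
      let ?A = "pverts G - D"
      have "twins G x y" if "x \<in> D" "y \<in> D" for x y
        using A that unfolding twin_base_def D_def by auto
      then have "determined_by G 2 ?A" using twins_determined_by[OF G DV] by blast
      moreover have "card ?A + card D = n"
        using DV finD n card_mono[of "pverts G" D] G by (simp add: order_def card_Diff_subset pair_graph_iff)
      ultimately show ?thesis using False bound[of ?A 2] by simp
    qed
  qed
qed

section \<open>Separated triples\<close>

text \<open>
  In the next two lemmas \<open>W\<close> is a set of pairwise non-twin vertices, \<open>E\<close> is adjacency, and \<open>T\<close>
  records the adjacencies to the vertices outside \<open>W\<close>. The path on four vertices with constant \<open>T\<close> is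
  the only obstruction for \<open>card W = 4\<close>, and assumption \<open>h\<close> excludes it.
\<close>

lemma four_separated_triple:
  fixes E :: "'a \<Rightarrow> 'a \<Rightarrow> bool" and T :: "'a \<Rightarrow> 'b"
  assumes sy: "\<And>x y. E x y = E y x" and d: "distinct [a, b, c, d]" and W: "W = {a, b, c, d}"
    and sep: "\<And>x y. x \<in> W \<Longrightarrow> y \<in> W \<Longrightarrow> x \<noteq> y \<Longrightarrow> T x = T y \<Longrightarrow> \<exists>w \<in> W - {x, y}. E x w \<noteq> E y w"
    and h: "T a = T b \<Longrightarrow> T b = T c \<Longrightarrow> T c = T d \<Longrightarrow> E a b = E a c \<and> E a c = E a d"
  shows "\<exists>x \<in> W. \<exists>y \<in> W. \<exists>z \<in> W. distinct [x, y, z] \<and>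
    (\<forall>u \<in> {x, y, z}. \<forall>v \<in> {x, y, z}. u \<noteq> v \<longrightarrow> T u = T v \<longrightarrow> (\<exists>w \<in> W - {x, y, z}. E u w \<noteq> E v w))"
    (is "\<exists>x \<in> W. \<exists>y \<in> W. \<exists>z \<in> W. ?Q x y z")
proof (rule ccontr)
  assume n: "\<not> ?thesis"
  note s = sep[of a b] sep[of a c] sep[of a d] sep[of b c] sep[of b d] sep[of c d]
  have nQ: "\<not> ?Q x y z" if "x \<in> W" "y \<in> W" "z \<in> W" for x y z using n that by blast
  note q = nQ[of a b c] nQ[of a b d] nQ[of a c d] nQ[of b c d]
  \<comment> \<open>After equality and adjacency of each unordered pair of vertices are oriented in
    one fixed way, only a finite case distinction on \<open>E\<close> and on equalities between
    values of \<open>T\<close> is left.\<close>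
  show False
    using s q d h unfolding W
    by (simp add: insert_Diff_if
        eq_commute[of b a] eq_commute[of c a] eq_commute[of d a] eq_commute[of c b] eq_commute[of d b]
        eq_commute[of d c] sy[of b a] sy[of c a] sy[of d a] sy[of c b] sy[of d b] sy[of d c])
      (smt (verit))
qed

lemma five_separated_triple:
  fixes E :: "'a \<Rightarrow> 'a \<Rightarrow> bool" and T :: "'a \<Rightarrow> 'b"
  assumes sy: "\<And>x y. E x y = E y x" and d: "distinct [a, b, c, d, e]" and W: "W = {a, b, c, d, e}"
    and sep: "\<And>x y. x \<in> W \<Longrightarrow> y \<in> W \<Longrightarrow> x \<noteq> y \<Longrightarrow> T x = T y \<Longrightarrow> \<exists>w \<in> W - {x, y}. E x w \<noteq> E y w"
  shows "\<exists>x \<in> W. \<exists>y \<in> W. \<exists>z \<in> W. distinct [x, y, z] \<and>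
    (\<forall>u \<in> {x, y, z}. \<forall>v \<in> {x, y, z}. u \<noteq> v \<longrightarrow> T u = T v \<longrightarrow> (\<exists>w \<in> W - {x, y, z}. E u w \<noteq> E v w))"
    (is "\<exists>x \<in> W. \<exists>y \<in> W. \<exists>z \<in> W. ?Q x y z")
proof (rule ccontr)
  assume n: "\<not> ?thesis"
  note s = sep[of a b] sep[of a c] sep[of a d] sep[of a e] sep[of b c] sep[of b d] sep[of b e]
    sep[of c d] sep[of c e] sep[of d e]
  have nQ: "\<not> ?Q x y z" if "x \<in> W" "y \<in> W" "z \<in> W" for x y z using n that by blast
  note q = nQ[of a b c] nQ[of a b d] nQ[of a b e] nQ[of a c d] nQ[of a c e] nQ[of a d e]
    nQ[of b c d] nQ[of b c e] nQ[of b d e] nQ[of c d e]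
  show False
    using s q d unfolding W
    by (simp add: insert_Diff_if
        eq_commute[of b a] eq_commute[of c a] eq_commute[of d a] eq_commute[of c b] eq_commute[of d b]
        eq_commute[of d c] eq_commute[of e a] eq_commute[of e b] eq_commute[of e c] eq_commute[of e d]
        sy[of b a] sy[of c a] sy[of d a] sy[of c b] sy[of d b] sy[of d c]
        sy[of e a] sy[of e b] sy[of e c] sy[of e d])
      (smt (verit))
qed

section \<open>Separated triples in graphs\<close>

lemma card_5E:
  assumes "card W = 5"
  obtains a b c d e where "W = {a, b, c, d, e}" "distinct [a, b, c, d, e]"
proof -
  have "finite W" using assms by (metis card.infinite zero_neq_numeral)
  then obtain xs where xs: "set xs = W" "distinct xs" using finite_distinct_list by blast
  then have "length xs = 5" using assms distinct_card by metis
  then obtain a b c d e where "xs = [a, b, c, d, e]"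
    by (auto simp: length_Suc_conv eval_nat_numeral)
  then show ?thesis using xs that by auto
qed

text \<open>All classes are singletons, so the twin condition is trivial and the size condition
  holds with \<open>r = 2\<close>.\<close>

lemma inj_ntype_determined_by:
  assumes G: "pair_graph G" and A: "A \<subseteq> pverts G" and inj: "inj_on (ntype G A) (pverts G - A)"
  shows "determined_by G 2 A"
proof (rule twin_base_determined_by[OF G])
  show "twin_base G A"
    using A inj by (auto simp: twin_base_def twins_def dest: inj_onD)
  have "{u \<in> pverts G - A. ntype G A u = ntype G A v} = {v}" if "v \<in> pverts G - A" for v
    using that inj by (auto dest: inj_onD)
  then show "(\<forall>u \<in> pverts G - A. \<forall>v \<in> pverts G - A. ntype G A u = ntype G A v) \<or>
      (\<forall>v \<in> pverts G - A. card {u \<in> pverts G - A. ntype G A u = ntype G A v} < 2)"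
    by simp
qed simp

lemma twins_sym: "twins G u v \<Longrightarrow> twins G v u"
  by (simp add: twins_def insert_commute)

text \<open>Compare through \<open>v\<close>; only the test vertex \<open>v\<close> itself needs
  care. There both adjacencies \<open>u\<close>-\<open>v\<close> and
  \<open>w\<close>-\<open>v\<close> agree with \<open>u\<close>-\<open>w\<close>, by the two
  hypotheses and symmetry.\<close>

lemma twins_trans:
  assumes G: "pair_graph G" and V: "u \<in> pverts G" "v \<in> pverts G" "w \<in> pverts G"
    and tw: "twins G u v" "twins G v w"
  shows "twins G u w"
proof (cases "u = v \<or> v = w \<or> u = w")
  case True
  then show ?thesis using tw twins_refl by metis
next
  case False
  have sy: "\<And>x y. (x, y) \<in> parcs G \<longleftrightarrow> (y, x) \<in> parcs G" using G by (auto simp: pair_graph_iff)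
  show ?thesis
    unfolding twins_iff
  proof
    fix x assume x: "x \<in> pverts G - {u, w}"
    show "(u, x) \<in> parcs G \<longleftrightarrow> (w, x) \<in> parcs G"
    proof (cases "x = v")
      case True
      have "(u, w) \<in> parcs G \<longleftrightarrow> (v, w) \<in> parcs G" "(v, u) \<in> parcs G \<longleftrightarrow> (w, u) \<in> parcs G"
        using tw V False unfolding twins_iff by auto
      then show ?thesis using True sy by metis
    next
      case False
      then show ?thesis using tw x unfolding twins_iff by auto
    qed
  qed
qed

text \<open>Leaving out such a triple makes all classes singletons, which gives \<open>n - 3\<close>
  existential and two universal variables for a graph of order \<open>n\<close>.\<close>

definition separated_triple :: "'a pair_pre_digraph \<Rightarrow> 'a \<Rightarrow> 'a \<Rightarrow> 'a \<Rightarrow> bool" where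
  "separated_triple G a b c \<longleftrightarrow> distinct [a, b, c] \<and> {a, b, c} \<subseteq> pverts G \<and>
    inj_on (ntype G (pverts G - {a, b, c})) {a, b, c}"

lemma not_twins_separated_in:
  assumes W: "W \<subseteq> pverts G" and nt: "\<not> twins G x y" and eq: "ntype G (pverts G - W) x = ntype G (pverts G - W) y"
  shows "\<exists>w \<in> W - {x, y}. ((x, w) \<in> parcs G) \<noteq> ((y, w) \<in> parcs G)"
  using nt eq unfolding twins_iff ntype_eq_iff by blast

text \<open>Interface to the two preceding combinatorial lemmas, with \<open>T\<close> the type over
  the vertices outside \<open>W\<close>. Two members of the triple differ either in \<open>T\<close>
  or at a vertex of \<open>W\<close> off the triple; in both cases the separator lies outside the
  triple.\<close>

lemma ex_separated_triple:
  assumes W: "W \<subseteq> pverts G"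
    and ex: "\<exists>x \<in> W. \<exists>y \<in> W. \<exists>z \<in> W. distinct [x, y, z] \<and>
      (\<forall>u \<in> {x, y, z}. \<forall>v \<in> {x, y, z}. u \<noteq> v \<longrightarrow>
        ntype G (pverts G - W) u = ntype G (pverts G - W) v \<longrightarrow>
        (\<exists>w \<in> W - {x, y, z}. ((u, w) \<in> parcs G) \<noteq> ((v, w) \<in> parcs G)))"
  shows "\<exists>x y z. separated_triple G x y z"
  using ex
proof (elim bexE conjE)
  fix x y z assume xyz: "x \<in> W" "y \<in> W" "z \<in> W" and d: "distinct [x, y, z]"
    and sep: "\<forall>u \<in> {x, y, z}. \<forall>v \<in> {x, y, z}. u \<noteq> v \<longrightarrow>
      ntype G (pverts G - W) u = ntype G (pverts G - W) v \<longrightarrow>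
      (\<exists>w \<in> W - {x, y, z}. ((u, w) \<in> parcs G) \<noteq> ((v, w) \<in> parcs G))"
  have "inj_on (ntype G (pverts G - {x, y, z})) {x, y, z}"
  proof (rule inj_onI, rule ccontr)
    fix u v assume uv: "u \<in> {x, y, z}" "v \<in> {x, y, z}" "u \<noteq> v"
      and eq: "ntype G (pverts G - {x, y, z}) u = ntype G (pverts G - {x, y, z}) v"
    have "ntype G (pverts G - W) u = ntype G (pverts G - W) v"
      using eq by (rule ntype_mono_eq) (use xyz in blast)
    then obtain w where "w \<in> W - {x, y, z}" "((u, w) \<in> parcs G) \<noteq> ((v, w) \<in> parcs G)"
      using sep uv by blast
    then show False using eq W unfolding ntype_eq_iff by blast
  qed
  then have "separated_triple G x y z"
    unfolding separated_triple_def using W xyz d by blast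
  then show ?thesis by blast
qed

text \<open>If \<open>c\<close> is the only vertex separating \<open>a\<close> from \<open>b\<close>, then \<open>c\<close> has no twin.\<close>

lemma not_twins_separated_outside:
  assumes G: "pair_graph G" and V: "{a, b, c, c'} \<subseteq> pverts G" and nt: "\<not> twins G a b"
    and c: "twins G c c'" "c' \<notin> {a, b, c}" "c \<noteq> a" "c \<noteq> b"
  shows "ntype G (pverts G - {a, b, c}) a \<noteq> ntype G (pverts G - {a, b, c}) b"
proof
  assume eq: "ntype G (pverts G - {a, b, c}) a = ntype G (pverts G - {a, b, c}) b"
  have sy: "\<And>x y. (x, y) \<in> parcs G \<longleftrightarrow> (y, x) \<in> parcs G" using G by (auto simp: pair_graph_iff)
  have "((a, c) \<in> parcs G) \<noteq> ((b, c) \<in> parcs G)"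
    using nt eq unfolding twins_iff ntype_eq_iff by blast
  moreover have "(a, c) \<in> parcs G \<longleftrightarrow> (a, c') \<in> parcs G" "(b, c) \<in> parcs G \<longleftrightarrow> (b, c') \<in> parcs G"
    using c V sy unfolding twins_iff by blast+
  moreover have "(a, c') \<in> parcs G \<longleftrightarrow> (b, c') \<in> parcs G"
    using eq c V unfolding ntype_eq_iff by blast
  ultimately show False by blast
qed

lemma is_cherry5I:
  assumes "pair_graph G" "distinct [c, x, y, u, v]" "pverts G = {c, x, y, u, v}"
    "parcs G = {(c, x), (x, c), (c, y), (y, c)}"
  shows "is_cherry5 G"
proof -
  have "edges G = {{c, x}, {c, y}}"
    unfolding edges_def assms(4) by (auto simp: insert_commute)
  moreover have "{c, x} \<noteq> {c, y}" "{c, x} \<inter> {c, y} \<noteq> {}"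
    using assms(2) by (auto simp: doubleton_eq_iff)
  ultimately have "\<exists>e f. edges G = {e, f} \<and> e \<noteq> f \<and> e \<inter> f \<noteq> {}" by blast
  then show ?thesis using assms(1-3) unfolding is_cherry5_def order_def by simp
qed

lemma pair_graph_complement: "pair_graph G \<Longrightarrow> pair_graph (complement_graph G)"
  by (auto simp: pair_graph_iff complement_graph_def)

lemma complement_graph_complement:
  assumes "pair_graph G"
  shows "complement_graph (complement_graph G) = G"
proof -
  have "parcs (complement_graph (complement_graph G)) = parcs G"
    using assms by (auto simp: pair_graph_iff complement_graph_def)
  moreover have "pverts (complement_graph (complement_graph G)) = pverts G"
    by (simp add: complement_graph_def)
  ultimately show ?thesis by simp
qed

text \<open>Only \<open>a\<close> and \<open>b\<close> can fail to be separated, so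
  \<open>a'\<close> and \<open>b'\<close> do not distinguish them, while \<open>c\<close> does.
  Exchanging twins then gives all pairs among \<open>a, a', b, b'\<close> the same status and joins
  \<open>c\<close> to exactly one of the two twin pairs.\<close>

lemma five_vertices_exception:
  assumes G: "pair_graph G" and V: "pverts G = {a, a', b, b', c}" and d: "distinct [a, a', b, b', c]"
    and tw: "twins G a a'" "twins G b b'"
    and nt: "\<not> twins G a b" "\<not> twins G a c" "\<not> twins G b c"
    and ns: "\<not> separated_triple G a b c"
  shows "is_cherry5 G \<or> is_cherry5 (complement_graph G)"
proof -
  have sy: "\<And>x y. (x, y) \<in> parcs G \<longleftrightarrow> (y, x) \<in> parcs G" and irr: "\<And>x. (x, x) \<notin> parcs G"
    and sub: "parcs G \<subseteq> pverts G \<times> pverts G" using G by (auto simp: pair_graph_iff)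
  let ?A = "pverts G - {a, b, c}"
  \<comment> \<open>A separator of \<open>a\<close> and \<open>c\<close> survives because
    \<open>b\<close> has its twin \<open>b'\<close> outside the triple; likewise \<open>a'\<close>
    serves for \<open>b\<close> and \<open>c\<close>.\<close>
  have "ntype G ?A a \<noteq> ntype G ?A c"
    using not_twins_separated_outside[OF G, of a c b b'] V d tw nt by (auto simp: insert_commute)
  moreover have "ntype G ?A b \<noteq> ntype G ?A c"
    using not_twins_separated_outside[OF G, of b c a a'] V d tw nt by (auto simp: insert_commute)
  ultimately have eq: "ntype G ?A a = ntype G ?A b"
    using ns d V unfolding separated_triple_def by (auto simp: inj_on_def)
  \<comment> \<open>\<open>p\<close> will be the common adjacency among the four vertices other than
    \<open>c\<close>, and \<open>q\<close> tells to which twin pair \<open>c\<close> is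
    joined.\<close>
  define p q where "p \<longleftrightarrow> (a, b) \<in> parcs G" and "q \<longleftrightarrow> (a, c) \<in> parcs G"
  have e: "(a, a') \<in> parcs G \<longleftrightarrow> (b, a') \<in> parcs G" "(a, b') \<in> parcs G \<longleftrightarrow> (b, b') \<in> parcs G"
    using eq V d unfolding ntype_eq_iff by auto
  have bc: "(b, c) \<in> parcs G \<longleftrightarrow> \<not> q"
    using nt(1) eq V d unfolding twins_iff ntype_eq_iff q_def by auto
  have a': "(a', b) \<in> parcs G \<longleftrightarrow> p" "(a', c) \<in> parcs G \<longleftrightarrow> q" "(a', b') \<in> parcs G \<longleftrightarrow> (a, b') \<in> parcs G"
    using tw(1) V d unfolding twins_iff p_def q_def by auto
  have b': "(b', a) \<in> parcs G \<longleftrightarrow> (b, a) \<in> parcs G" "(b', c) \<in> parcs G \<longleftrightarrow> \<not> q"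
    using tw(2) V d bc unfolding twins_iff by auto
  have adj: "(a, b) \<in> parcs G \<longleftrightarrow> p" "(a, a') \<in> parcs G \<longleftrightarrow> p" "(a, b') \<in> parcs G \<longleftrightarrow> p"
    "(b, a') \<in> parcs G \<longleftrightarrow> p" "(b, b') \<in> parcs G \<longleftrightarrow> p" "(a', b') \<in> parcs G \<longleftrightarrow> p"
    "(a, c) \<in> parcs G \<longleftrightarrow> q" "(a', c) \<in> parcs G \<longleftrightarrow> q"
    "(b, c) \<in> parcs G \<longleftrightarrow> \<not> q" "(b', c) \<in> parcs G \<longleftrightarrow> \<not> q"
    using e a' b' bc sy p_def q_def by blast+
  have adj': "(b, a) \<in> parcs G \<longleftrightarrow> p" "(a', a) \<in> parcs G \<longleftrightarrow> p" "(b', a) \<in> parcs G \<longleftrightarrow> p"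
    "(a', b) \<in> parcs G \<longleftrightarrow> p" "(b', b) \<in> parcs G \<longleftrightarrow> p" "(b', a') \<in> parcs G \<longleftrightarrow> p"
    "(c, a) \<in> parcs G \<longleftrightarrow> q" "(c, a') \<in> parcs G \<longleftrightarrow> q"
    "(c, b) \<in> parcs G \<longleftrightarrow> \<not> q" "(c, b') \<in> parcs G \<longleftrightarrow> \<not> q"
    using adj sy by blast+
  have V': "pverts G = {c, a, a', b, b'}" "pverts G = {c, b, b', a, a'}" using V by auto
  have dd: "distinct [c, a, a', b, b']" "distinct [c, b, b', a, a']" using d by auto
  have ext: "R = S" if "R \<subseteq> pverts G \<times> pverts G" "S \<subseteq> pverts G \<times> pverts G"
      "\<forall>x \<in> pverts G. \<forall>y \<in> pverts G. (x, y) \<in> R \<longleftrightarrow> (x, y) \<in> S" for R S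
    using that by auto
  show ?thesis
  proof (cases p)
    case False
    show ?thesis
    proof (cases q)
      case True
      have "parcs G = {(c, a), (a, c), (c, a'), (a', c)}"
        using False True d by (intro ext[OF sub]) (auto simp: V adj adj' irr)
      then show ?thesis using is_cherry5I[OF G dd(1) V'(1)] by blast
    next
      case nq: False
      have "parcs G = {(c, b), (b, c), (c, b'), (b', c)}"
        using False nq d by (intro ext[OF sub]) (auto simp: V adj adj' irr)
      then show ?thesis using is_cherry5I[OF G dd(2) V'(2)] by blast
    qed
  next
    case True
    \<comment> \<open>Here the four vertices form a clique; complementing makes them independent and
      joins \<open>c\<close> to the opposite pair.\<close>
    let ?C = "complement_graph G"
    have C: "pair_graph ?C" using G by (rule pair_graph_complement)
    have VC: "pverts ?C = pverts G" by (simp add: complement_graph_def)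
    have subC: "parcs ?C \<subseteq> pverts G \<times> pverts G" by (auto simp: complement_graph_def)
    have EC: "(x, y) \<in> parcs ?C \<longleftrightarrow> x \<noteq> y \<and> (x, y) \<notin> parcs G" if "x \<in> pverts G" "y \<in> pverts G" for x y
      using that by (simp add: complement_graph_def)
    show ?thesis
    proof (cases q)
      case nq: True
      have "parcs ?C = {(c, b), (b, c), (c, b'), (b', c)}"
      proof (rule ext[OF subC])
        show "\<forall>x \<in> pverts G. \<forall>y \<in> pverts G. (x, y) \<in> parcs ?C \<longleftrightarrow> (x, y) \<in> {(c, b), (b, c), (c, b'), (b', c)}"
          using True nq d by (simp add: EC cong: ball_cong) (auto simp: V adj adj' irr)
      qed (auto simp: V)
      then show ?thesis using is_cherry5I[OF C dd(2)] V'(2) VC by auto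
    next
      case False
      have "parcs ?C = {(c, a), (a, c), (c, a'), (a', c)}"
      proof (rule ext[OF subC])
        show "\<forall>x \<in> pverts G. \<forall>y \<in> pverts G. (x, y) \<in> parcs ?C \<longleftrightarrow> (x, y) \<in> {(c, a), (a, c), (c, a'), (a', c)}"
          using True False d by (simp add: EC cong: ball_cong) (auto simp: V adj adj' irr)
      qed (auto simp: V)
      then show ?thesis using is_cherry5I[OF C dd(1)] V'(1) VC by auto
    qed
  qed
qed

text \<open>Assume neither alternative and take a largest set \<open>W\<close> of pairwise
  non-twins. Five vertices in \<open>W\<close>, three vertices outside it, or exactly four in it
  would each give a separated triple, leaving the case of three and two, which is the
  exception.\<close>

lemma three_twins_or_separated_triple:
  assumes G: "pair_graph G" and n: "card (pverts G) \<ge> 5"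
    and nc: "\<not> (is_cherry5 G \<or> is_cherry5 (complement_graph G))"
  shows "(\<exists>a b c. distinct [a, b, c] \<and> {a, b, c} \<subseteq> pverts G \<and> (\<forall>x \<in> {a, b, c}. \<forall>y \<in> {a, b, c}. twins G x y)) \<or>
    (\<exists>a b c. separated_triple G a b c)"
proof (rule ccontr)
  let ?V = "pverts G"
  assume "\<not> ?thesis"
  then have n3: "\<And>a b c. distinct [a, b, c] \<Longrightarrow> {a, b, c} \<subseteq> ?V \<Longrightarrow> \<exists>x \<in> {a, b, c}. \<exists>y \<in> {a, b, c}. \<not> twins G x y"
    and ns: "\<And>a b c. \<not> separated_triple G a b c"
    by blast+
  have fin: "finite ?V" using G by (simp add: pair_graph_iff)
  have sy: "\<And>x y. (x, y) \<in> parcs G \<longleftrightarrow> (y, x) \<in> parcs G" using G by (auto simp: pair_graph_iff)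
  define P where "P W \<longleftrightarrow> W \<subseteq> ?V \<and> (\<forall>x \<in> W. \<forall>y \<in> W. x \<noteq> y \<longrightarrow> \<not> twins G x y)" for W
  have "P {}" by (simp add: P_def)
  moreover have "\<And>W. P W \<Longrightarrow> card W \<le> card ?V" using fin by (auto simp: P_def intro: card_mono)
  ultimately obtain W where W: "P W" and Wmax: "\<And>W'. P W' \<Longrightarrow> card W' \<le> card W"
    using obtain_max_nat[of P "{}" card "card ?V"] by metis
  have WV: "W \<subseteq> ?V" and nt: "\<And>x y. x \<in> W \<Longrightarrow> y \<in> W \<Longrightarrow> x \<noteq> y \<Longrightarrow> \<not> twins G x y"
    using W by (auto simp: P_def)
  have finW: "finite W" using WV fin by (rule finite_subset)
  have "\<exists>w \<in> W. twins G w v" if v: "v \<in> ?V - W" for v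
  proof (rule ccontr)
    assume "\<not> ?thesis"
    then have "\<not> twins G w v" "\<not> twins G v w" if "w \<in> W" for w
      using that twins_sym[of G v w] by auto
    then have "P (insert v W)" using W v unfolding P_def by auto
    then show False using Wmax[of "insert v W"] v finW by simp
  qed
  then obtain \<rho> where \<rho>: "\<And>v. v \<in> ?V - W \<Longrightarrow> \<rho> v \<in> W \<and> twins G (\<rho> v) v" by metis
  \<comment> \<open>Two outside vertices with a common representative would form three mutual twins
    with it.\<close>
  have inj: "inj_on \<rho> (?V - W)"
  proof (rule inj_onI, rule ccontr)
    fix u v assume uv: "u \<in> ?V - W" "v \<in> ?V - W" "\<rho> u = \<rho> v" "u \<noteq> v"
    let ?w = "\<rho> u"
    have t: "twins G ?w u" "twins G ?w v" "?w \<in> W" using \<rho>[of u] \<rho>[of v] uv by auto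
    note t' = t(1,2)[THEN twins_sym]
    have uv': "twins G u v" using twins_trans[OF G _ _ _ t'(1) t(2)] t(3) uv WV by blast
    have "\<forall>x \<in> {?w, u, v}. \<forall>y \<in> {?w, u, v}. twins G x y"
      using t t' uv' twins_sym[OF uv'] by (simp add: twins_refl)
    moreover have "distinct [?w, u, v]" "{?w, u, v} \<subseteq> ?V" using uv t WV by auto
    ultimately show False using n3 by blast
  qed
  have cV: "card ?V = card W + card (?V - W)"
    using WV fin finW by (simp add: card_Diff_subset card_mono)
  have cle: "card (?V - W) \<le> card W"
    using card_inj_on_le[OF inj _ finW] \<rho> by blast
  have "card W < 5"
  proof (rule ccontr)
    assume "\<not> card W < 5"
    then obtain W' where W': "W' \<subseteq> W" "card W' = 5"
      by (metis not_less obtain_subset_with_card_n)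
    from card_5E[OF W'(2)]
    obtain a b c d e where abc: "W' = {a, b, c, d, e}" "distinct [a, b, c, d, e]" .
    have "\<exists>x \<in> W'. \<exists>y \<in> W'. \<exists>z \<in> W'. distinct [x, y, z] \<and>
      (\<forall>u \<in> {x, y, z}. \<forall>v \<in> {x, y, z}. u \<noteq> v \<longrightarrow> ntype G (?V - W') u = ntype G (?V - W') v \<longrightarrow>
        (\<exists>w \<in> W' - {x, y, z}. ((u, w) \<in> parcs G) \<noteq> ((v, w) \<in> parcs G)))"
    proof (rule five_separated_triple[OF _ abc(2) abc(1)])
      fix x y assume "x \<in> W'" "y \<in> W'" "x \<noteq> y" "ntype G (?V - W') x = ntype G (?V - W') y"
      then show "\<exists>w \<in> W' - {x, y}. ((x, w) \<in> parcs G) \<noteq> ((y, w) \<in> parcs G)"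
        using not_twins_separated_in[of W' G x y] W' WV nt by blast
    qed (rule sy)
    moreover have "W' \<subseteq> ?V" using W' WV by blast
    ultimately show False using ex_separated_triple[of W' G] ns by blast
  qed
  \<comment> \<open>For three representatives with twins outside \<open>W\<close>, none can be the
    only separator of the other two, so they form a separated triple.\<close>
  moreover have "card (?V - W) < 3"
  proof (rule ccontr)
    assume "\<not> card (?V - W) < 3"
    then obtain U where U: "U \<subseteq> ?V - W" "card U = 3"
      by (metis not_less obtain_subset_with_card_n)
    then obtain a' b' c' where abc: "U = {a', b', c'}" "distinct [a', b', c']"
      by (auto simp: card_3_iff)
    let ?a = "\<rho> a'" and ?b = "\<rho> b'" and ?c = "\<rho> c'"
    have r: "?a \<in> W" "?b \<in> W" "?c \<in> W" "twins G ?a a'" "twins G ?b b'" "twins G ?c c'"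
      using \<rho> U abc by auto
    have d: "?a \<noteq> ?b" "?a \<noteq> ?c" "?b \<noteq> ?c" using inj U abc by (auto dest: inj_onD)
    have out: "a' \<notin> {?a, ?b, ?c}" "b' \<notin> {?a, ?b, ?c}" "c' \<notin> {?a, ?b, ?c}" using r U abc by auto
    have V: "{?a, ?b, ?c, a', b', c'} \<subseteq> ?V" using r U abc WV by auto
    have "ntype G (?V - {?a, ?b, ?c}) ?a \<noteq> ntype G (?V - {?a, ?b, ?c}) ?b"
      using not_twins_separated_outside[OF G, of ?a ?b ?c c'] V nt r d out by (auto simp: insert_commute)
    moreover have "ntype G (?V - {?a, ?b, ?c}) ?a \<noteq> ntype G (?V - {?a, ?b, ?c}) ?c"
      using not_twins_separated_outside[OF G, of ?a ?c ?b b'] V nt r d out by (auto simp: insert_commute)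
    moreover have "ntype G (?V - {?a, ?b, ?c}) ?b \<noteq> ntype G (?V - {?a, ?b, ?c}) ?c"
      using not_twins_separated_outside[OF G, of ?b ?c ?a a'] V nt r d out by (auto simp: insert_commute)
    ultimately have "separated_triple G ?a ?b ?c"
      using d V by (auto simp: separated_triple_def inj_on_def)
    then show False using ns by blast
  qed
  moreover have "card W \<noteq> 4"
  proof
    assume W4: "card W = 4"
    then have "card (?V - W) \<noteq> 0" using cV n by linarith
    then have "?V - W \<noteq> {}" by (metis card.empty)
    then obtain v where v: "v \<in> ?V - W" by blast
    define a where "a = \<rho> v"
    have a: "a \<in> W" "twins G a v" using \<rho>[OF v] by (auto simp: a_def)
    then have "card (W - {a}) = 3" using W4 finW by simp
    then obtain b c d where "W - {a} = {b, c, d}" "distinct [b, c, d]"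
      by (auto simp: card_3_iff)
    then have abc: "W = {a, b, c, d}" "distinct [a, b, c, d]" using a by auto
    have "\<exists>x \<in> W. \<exists>y \<in> W. \<exists>z \<in> W. distinct [x, y, z] \<and>
      (\<forall>u \<in> {x, y, z}. \<forall>v \<in> {x, y, z}. u \<noteq> v \<longrightarrow> ntype G (?V - W) u = ntype G (?V - W) v \<longrightarrow>
        (\<exists>w \<in> W - {x, y, z}. ((u, w) \<in> parcs G) \<noteq> ((v, w) \<in> parcs G)))"
    proof (rule four_separated_triple[OF _ abc(2) abc(1)])
      fix x y assume "x \<in> W" "y \<in> W" "x \<noteq> y" "ntype G (?V - W) x = ntype G (?V - W) y"
      then show "\<exists>w \<in> W - {x, y}. ((x, w) \<in> parcs G) \<noteq> ((y, w) \<in> parcs G)"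
        using not_twins_separated_in[of W G x y] WV nt by blast
    next
      \<comment> \<open>With constant types, the twin \<open>v\<close> of \<open>a\<close> is
        adjacent to all or none of \<open>b\<close>, \<open>c\<close>, \<open>d\<close>; hence so is
        \<open>a\<close>, which is assumption \<open>h\<close> excluding the path.\<close>
      assume "ntype G (?V - W) a = ntype G (?V - W) b" "ntype G (?V - W) b = ntype G (?V - W) c"
        "ntype G (?V - W) c = ntype G (?V - W) d"
      then have "(b, v) \<in> parcs G \<longleftrightarrow> (c, v) \<in> parcs G" "(c, v) \<in> parcs G \<longleftrightarrow> (d, v) \<in> parcs G"
        using v unfolding ntype_eq_iff by blast+
      moreover have "(a, w) \<in> parcs G \<longleftrightarrow> (v, w) \<in> parcs G" if "w \<in> W - {a}" for w
        using a(2) that v WV unfolding twins_iff by blast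
      ultimately show "((a, b) \<in> parcs G) = ((a, c) \<in> parcs G) \<and> ((a, c) \<in> parcs G) = ((a, d) \<in> parcs G)"
        using abc sy by auto
    qed (rule sy)
    then show False using ex_separated_triple[OF WV] ns by blast
  qed
  ultimately have c3: "card W = 3" "card (?V - W) = 2" using cV cle n by linarith+
  then obtain a' b' where ab': "?V - W = {a', b'}" "a' \<noteq> b'" by (auto simp: card_2_iff)
  let ?a = "\<rho> a'" and ?b = "\<rho> b'"
  have r: "?a \<in> W" "?b \<in> W" "twins G ?a a'" "twins G ?b b'" using \<rho> ab' by auto
  have d: "?a \<noteq> ?b" using inj ab' by (auto dest: inj_onD)
  have "card (W - {?a, ?b}) = 1" using c3 r d finW by (simp add: card_Diff_subset)
  then obtain c where c: "W - {?a, ?b} = {c}" by (auto simp: card_Suc_eq)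
  then have Wc: "W = {?a, ?b, c}" "c \<noteq> ?a" "c \<noteq> ?b" using r by auto
  have V: "?V = {?a, a', ?b, b', c}" using ab' Wc WV by blast
  have dd: "distinct [?a, a', ?b, b', c]" using Wc d ab' by auto
  have "is_cherry5 G \<or> is_cherry5 (complement_graph G)"
    by (rule five_vertices_exception[OF G V dd r(3,4) _ _ _ ns]) (use nt r Wc d in auto)
  then show False using nc by blast
qed

lemma BS_restr_2_le:
  assumes G: "pair_graph G" and n: "card (pverts G) \<ge> 5"
    and nc: "\<not> (is_cherry5 G \<or> is_cherry5 (complement_graph G))"
  shows "BS_restr 2 G \<le> enat (card (pverts G) - 1)"
proof -
  let ?V = "pverts G"
  have "\<exists>D \<subseteq> ?V. card D = 3 \<and> determined_by G 2 (?V - D)"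
    using three_twins_or_separated_triple[OF assms]
  proof (elim disjE exE conjE)
    fix a b c assume "distinct [a, b, c]" "{a, b, c} \<subseteq> ?V" "\<forall>x \<in> {a, b, c}. \<forall>y \<in> {a, b, c}. twins G x y"
    then show ?thesis using twins_determined_by[OF G, of "{a, b, c}"] by (intro exI[of _ "{a, b, c}"]) simp
  next
    fix a b c assume s: "separated_triple G a b c"
    then have "?V - (?V - {a, b, c}) = {a, b, c}" by (auto simp: separated_triple_def)
    then show ?thesis
      using s inj_ntype_determined_by[OF G, of "?V - {a, b, c}"]
      by (intro exI[of _ "{a, b, c}"]) (auto simp: separated_triple_def)
  qed
  then obtain D where D: "D \<subseteq> ?V" "card D = 3" "determined_by G 2 (?V - D)" by blast
  have "finite D" using D(2) by (metis card.infinite zero_neq_numeral)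
  then have "card (?V - D) + 2 = card ?V - 1"
    using D n by (simp add: card_Diff_subset)
  then show ?thesis using BS_le(2)[OF G Diff_subset _ D(3), of 2] by simp
qed

section \<open>The exceptional graph\<close>

text \<open>The invariant by which competitors of the exceptional graph are seen to be
  non-isomorphic to it.\<close>

lemma card_parcs_graph_iso:
  assumes "graph_iso G H"
  shows "card (parcs G) = card (parcs H)"
proof -
  obtain f where f: "pre_digraph.digraph_isomorphism (with_proj G) f" "with_proj H = app_iso f (with_proj G)"
    using assms unfolding digraph_iso_def by blast
  have "parcs H = iso_arcs f ` parcs G" using arg_cong[OF f(2), of arcs] by simp
  moreover have "inj_on (iso_arcs f) (parcs G)"
    using f(1) by (simp add: pre_digraph.digraph_isomorphism_def)
  ultimately show ?thesis by (simp add: card_image)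
qed

section \<open>Passing to the complement\<close>

lemma pverts_complement [simp]: "pverts (complement_graph G) = pverts G"
  by (simp add: complement_graph_def)

lemma parcs_complement_iff:
  "u \<in> pverts G \<Longrightarrow> v \<in> pverts G \<Longrightarrow> (u, v) \<in> parcs (complement_graph G) \<longleftrightarrow> u \<noteq> v \<and> (u, v) \<notin> parcs G"
  by (simp add: complement_graph_def)

text \<open>The same maps work: an injection that preserves and reflects adjacency also preserves
  and reflects its complement.\<close>

lemma back_embeds_complement:
  assumes "back_embeds r A f G H"
  shows "back_embeds r A f (complement_graph G) (complement_graph H)"
  unfolding back_embeds_def pverts_complement
proof (intro conjI allI impI)
  show fA: "f ` A \<subseteq> pverts H" using assms by (simp add: back_embeds_def)
  fix R assume R: "R \<subseteq> pverts H" "card R \<le> r"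
  obtain g where g: "inj_on g (f ` A \<union> R)" "g ` (f ` A \<union> R) \<subseteq> pverts G" "\<forall>a \<in> A. g (f a) = a"
    "\<forall>u \<in> f ` A \<union> R. \<forall>v \<in> f ` A \<union> R. (u, v) \<in> parcs H \<longleftrightarrow> (g u, g v) \<in> parcs G"
    using back_embedsE[OF assms R] .
  have "(u, v) \<in> parcs (complement_graph H) \<longleftrightarrow> (g u, g v) \<in> parcs (complement_graph G)"
    if uv: "u \<in> f ` A \<union> R" "v \<in> f ` A \<union> R" for u v
  proof -
    have "u \<in> pverts H" "v \<in> pverts H" "g u \<in> pverts G" "g v \<in> pverts G"
      using uv fA R g(2) by blast+
    moreover have "u = v \<longleftrightarrow> g u = g v" using uv g(1) by (auto dest: inj_onD)
    ultimately show ?thesis using g(4) uv by (simp add: parcs_complement_iff)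
  qed
  then show "\<exists>g. inj_on g (f ` A \<union> R) \<and> g ` (f ` A \<union> R) \<subseteq> pverts G \<and> (\<forall>a \<in> A. g (f a) = a) \<and>
    (\<forall>u \<in> f ` A \<union> R. \<forall>v \<in> f ` A \<union> R.
      (u, v) \<in> parcs (complement_graph H) \<longleftrightarrow> (g u, g v) \<in> parcs (complement_graph G))"
    using g(1-3) by (intro exI[of _ g]) simp
qed

lemma graph_iso_complement:
  assumes G: "pair_graph G" and H: "pair_graph H" and iso: "graph_iso G H"
  shows "graph_iso (complement_graph G) (complement_graph H)"
proof -
  obtain h where h: "bij_betw h (pverts G) (pverts H)"
    "\<forall>u \<in> pverts G. \<forall>v \<in> pverts G. (u, v) \<in> parcs G \<longleftrightarrow> (h u, h v) \<in> parcs H"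
    using iso graph_iso_iff[OF G H] by blast
  have "(u, v) \<in> parcs (complement_graph G) \<longleftrightarrow> (h u, h v) \<in> parcs (complement_graph H)"
    if uv: "u \<in> pverts G" "v \<in> pverts G" for u v
  proof -
    have "h u \<in> pverts H" "h v \<in> pverts H" using h(1) uv by (auto simp: bij_betw_def)
    moreover have "u = v \<longleftrightarrow> h u = h v" using uv h(1) by (auto simp: bij_betw_def dest: inj_onD)
    ultimately show ?thesis using h(2) uv by (simp add: parcs_complement_iff)
  qed
  then show ?thesis
    using h(1) graph_iso_iff[OF pair_graph_complement[OF G] pair_graph_complement[OF H]] by auto
qed

lemma determined_by_complement:
  assumes G: "pair_graph G" and det: "determined_by G r A"
  shows "determined_by (complement_graph G) r A"
  unfolding determined_by_def
proof (intro allI impI, elim conjE exE)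
  fix H :: "'a pair_pre_digraph" and f
  assume H: "pair_graph H" and ord: "order H = order (complement_graph G)"
    and f: "back_embeds r A f (complement_graph G) H"
  let ?H = "complement_graph H"
  have "pair_graph ?H" using H by (rule pair_graph_complement)
  moreover have "order ?H = order G" using ord by (simp add: order_def)
  moreover have "back_embeds r A f G ?H"
    using back_embeds_complement[OF f] by (simp add: complement_graph_complement[OF G])
  ultimately have "graph_iso G ?H" using det unfolding determined_by_def by blast
  then have "graph_iso (complement_graph G) (complement_graph ?H)"
    using G H by (intro graph_iso_complement pair_graph_complement)
  then show "graph_iso (complement_graph G) H" by (simp add: complement_graph_complement[OF H])
qed

text \<open>A partial embedding over \<open>B\<close> restricts to one over \<open>A\<close>. This
  allows a determining set to be padded to a convenient size.\<close>

lemma determined_by_superset: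
  assumes det: "determined_by G r A" and AB: "A \<subseteq> B"
  shows "determined_by G r B"
proof -
  have "back_embeds r A f G H" if f: "back_embeds r B f G H" for f and H :: "'a pair_pre_digraph"
    unfolding back_embeds_def
  proof (intro conjI allI impI)
    show "f ` A \<subseteq> pverts H" using f AB by (auto simp: back_embeds_def)
    fix R assume R: "R \<subseteq> pverts H" "card R \<le> r"
    obtain g where g: "inj_on g (f ` B \<union> R)" "g ` (f ` B \<union> R) \<subseteq> pverts G" "\<forall>a \<in> B. g (f a) = a"
      "\<forall>u \<in> f ` B \<union> R. \<forall>v \<in> f ` B \<union> R. (u, v) \<in> parcs H \<longleftrightarrow> (g u, g v) \<in> parcs G"
      using back_embedsE[OF f R] .
    have sub: "f ` A \<union> R \<subseteq> f ` B \<union> R" using AB by blast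
    show "\<exists>g. inj_on g (f ` A \<union> R) \<and> g ` (f ` A \<union> R) \<subseteq> pverts G \<and> (\<forall>a \<in> A. g (f a) = a) \<and>
        (\<forall>u \<in> f ` A \<union> R. \<forall>v \<in> f ` A \<union> R. (u, v) \<in> parcs H \<longleftrightarrow> (g u, g v) \<in> parcs G)"
    proof (rule exI[of _ g], intro conjI ballI)
      show "inj_on g (f ` A \<union> R)" using g(1) sub by (rule inj_on_subset)
      show "g ` (f ` A \<union> R) \<subseteq> pverts G" using g(2) sub by blast
      show "g (f a) = a" if "a \<in> A" for a using g(3) AB that by blast
      show "(u, v) \<in> parcs H \<longleftrightarrow> (g u, g v) \<in> parcs G" if "u \<in> f ` A \<union> R" "v \<in> f ` A \<union> R" for u v
        by (rule g(4)[rule_format, OF subsetD[OF sub that(1)] subsetD[OF sub that(2)]])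
    qed
  qed
  then show ?thesis using det unfolding determined_by_def by blast
qed

text \<open>Changing the status of the single pair \<open>p\<close>, \<open>q\<close>, which no
  tested set contains, is invisible to the identity embedding but changes the number of
  arcs.\<close>

lemma not_determined_by_flip:
  assumes G: "pair_graph G" and pq: "p \<in> pverts G" "q \<in> pverts G" "p \<noteq> q" and B: "B \<subseteq> pverts G"
    and miss: "\<And>R. R \<subseteq> pverts G \<Longrightarrow> card R \<le> r \<Longrightarrow> \<not> {p, q} \<subseteq> B \<union> R"
  shows "\<not> determined_by G r B"
proof
  assume det: "determined_by G r B"
  let ?F = "{(p, q), (q, p)}"
  define H where "H = \<lparr>pverts = pverts G,
    parcs = (if (p, q) \<in> parcs G then parcs G - ?F else parcs G \<union> ?F)\<rparr>"
  have sy: "(q, p) \<in> parcs G \<longleftrightarrow> (p, q) \<in> parcs G" using G by (auto simp: pair_graph_iff)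
  have H: "pair_graph H" using G pq by (auto simp: pair_graph_iff H_def)
  have finE: "finite (parcs G)"
    using G unfolding pair_graph_iff by (meson finite_SigmaI finite_subset)
  have cF: "card ?F = 2" using pq by simp
  have "card (parcs G) \<noteq> card (parcs H)"
  proof (cases "(p, q) \<in> parcs G")
    case True
    then have "?F \<subseteq> parcs G" using sy by simp
    then show ?thesis using True finE cF card_mono[of "parcs G" ?F] by (simp add: H_def card_Diff_subset)
  next
    case False
    then have "parcs G \<inter> ?F = {}" using sy by simp
    then have "card (parcs G \<union> ?F) = card (parcs G) + card ?F" using finE by (intro card_Un_disjoint) auto
    moreover have "parcs H = parcs G \<union> ?F" using False by (simp add: H_def)
    ultimately show ?thesis unfolding cF by (metis add_eq_self_zero zero_neq_numeral)
  qed
  moreover have "back_embeds r B id G H"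
    unfolding back_embeds_def
  proof (intro conjI allI impI)
    show "id ` B \<subseteq> pverts H" using B by (simp add: H_def)
    fix R assume R: "R \<subseteq> pverts H" "card R \<le> r"
    then have "\<not> {p, q} \<subseteq> B \<union> R" using miss by (simp add: H_def)
    then have "(u, v) \<in> parcs H \<longleftrightarrow> (u, v) \<in> parcs G" if "u \<in> B \<union> R" "v \<in> B \<union> R" for u v
      using that by (auto simp: H_def)
    then show "\<exists>g. inj_on g (id ` B \<union> R) \<and> g ` (id ` B \<union> R) \<subseteq> pverts G \<and> (\<forall>a \<in> B. g (id a) = a) \<and>
        (\<forall>u \<in> id ` B \<union> R. \<forall>v \<in> id ` B \<union> R. (u, v) \<in> parcs H \<longleftrightarrow> (g u, g v) \<in> parcs G)"
      using R B by (intro exI[of _ id]) (simp add: H_def)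
  qed
  moreover have "order H = order G" by (simp add: H_def order_def)
  ultimately show False using det H card_parcs_graph_iso[of G H] unfolding determined_by_def by blast
qed

text \<open>The embedding fixes \<open>B\<close> and sends a tested pair \<open>x\<close>,
  \<open>y\<close> to a pair of \<open>G\<close> that looks the same over \<open>B\<close>. The arc
  counts rule out an isomorphism.\<close>

lemma not_determined_by_2I:
  assumes G: "pair_graph G" and H: "pair_graph H" and V: "pverts H = pverts G"
    and ne: "card (parcs G) \<noteq> card (parcs H)" and B: "B \<subseteq> pverts G" "card (pverts G - B) \<ge> 2"
    and agree: "\<forall>a \<in> B. \<forall>b \<in> B. (a, b) \<in> parcs H \<longleftrightarrow> (a, b) \<in> parcs G"
    and pairs: "\<forall>x \<in> pverts G - B. \<forall>y \<in> pverts G - B. x \<noteq> y \<longrightarrow>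
      (\<exists>x' \<in> pverts G - B. \<exists>y' \<in> pverts G - B. x' \<noteq> y' \<and> ((x, y) \<in> parcs H \<longleftrightarrow> (x', y') \<in> parcs G) \<and>
        (\<forall>b \<in> B. ((x, b) \<in> parcs H \<longleftrightarrow> (x', b) \<in> parcs G) \<and> ((y, b) \<in> parcs H \<longleftrightarrow> (y', b) \<in> parcs G)))"
  shows "\<not> determined_by G 2 B"
proof
  assume det: "determined_by G 2 B"
  have fin: "finite (pverts G)" using G by (simp add: pair_graph_iff)
  have sy: "\<And>x y. (x, y) \<in> parcs G \<longleftrightarrow> (y, x) \<in> parcs G" "\<And>x y. (x, y) \<in> parcs H \<longleftrightarrow> (y, x) \<in> parcs H"
    and irr: "\<And>x. (x, x) \<notin> parcs G" "\<And>x. (x, x) \<notin> parcs H"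
    using G H by (auto simp: pair_graph_iff)
  have "back_embeds 2 B id G H"
    unfolding back_embeds_def
  proof (intro conjI allI impI)
    show "id ` B \<subseteq> pverts H" using B V by simp
    fix R assume R: "R \<subseteq> pverts H" "card R \<le> 2"
    have "finite R" using R(1) V fin by (simp add: finite_subset)
    then have c2: "card (R - B) \<le> 2" using R(2) card_mono[of R "R - B"] by auto
    have sub: "R - B \<subseteq> pverts G - B" using R(1) V by blast
    \<comment> \<open>Smaller tested sets are padded to exactly two vertices outside
      \<open>B\<close>, so that \<open>pairs\<close> applies.\<close>
    obtain P where P: "R - B \<subseteq> P" "P \<subseteq> pverts G - B" "card P = 2"
      using exists_subset_between[OF c2 B(2) sub finite_Diff[OF fin]] by blast
    then obtain x y where xy: "P = {x, y}" "x \<noteq> y" by (auto simp: card_2_iff)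
    then have xyB: "x \<in> pverts G - B" "y \<in> pverts G - B" using P by auto
    from pairs[rule_format, OF xyB xy(2)]
    obtain x' y' where x'y': "x' \<in> pverts G - B" "y' \<in> pverts G - B" "x' \<noteq> y'"
      and e: "(x, y) \<in> parcs H \<longleftrightarrow> (x', y') \<in> parcs G"
      and bb: "\<forall>b \<in> B. ((x, b) \<in> parcs H \<longleftrightarrow> (x', b) \<in> parcs G) \<and> ((y, b) \<in> parcs H \<longleftrightarrow> (y', b) \<in> parcs G)"
      by (elim bexE conjE) (rule that)
    have b: "\<And>b. b \<in> B \<Longrightarrow> (x, b) \<in> parcs H \<longleftrightarrow> (x', b) \<in> parcs G"
        "\<And>b. b \<in> B \<Longrightarrow> (y, b) \<in> parcs H \<longleftrightarrow> (y', b) \<in> parcs G"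
      using bb by blast+
    define g where "g w = (if w = x then x' else if w = y then y' else w)" for w
    have gB: "g w = w" if "w \<in> B" for w using that xyB by (auto simp: g_def)
    have gxy: "g x = x'" "g y = y'" using xy by (auto simp: g_def)
    have e': "(y, x) \<in> parcs H \<longleftrightarrow> (y', x') \<in> parcs G" using e sy by blast
    have b': "\<And>b. b \<in> B \<Longrightarrow> (b, x) \<in> parcs H \<longleftrightarrow> (b, x') \<in> parcs G"
        "\<And>b. b \<in> B \<Longrightarrow> (b, y) \<in> parcs H \<longleftrightarrow> (b, y') \<in> parcs G"
      using b sy by blast+
    have sub: "id ` B \<union> R \<subseteq> B \<union> {x, y}" using P(1) xy by auto
    have "inj_on g (B \<union> {x, y})"
      using x'y' by (auto simp: inj_on_def gB gxy)
    moreover have "g ` (B \<union> {x, y}) \<subseteq> pverts G" using x'y' B by (auto simp: gB gxy)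
    moreover have "\<forall>u \<in> B \<union> {x, y}. \<forall>v \<in> B \<union> {x, y}. (u, v) \<in> parcs H \<longleftrightarrow> (g u, g v) \<in> parcs G"
      using agree by (simp add: ball_Un gB gxy b b' e e' irr)
    ultimately show "\<exists>g. inj_on g (id ` B \<union> R) \<and> g ` (id ` B \<union> R) \<subseteq> pverts G \<and> (\<forall>a \<in> B. g (id a) = a) \<and>
        (\<forall>u \<in> id ` B \<union> R. \<forall>v \<in> id ` B \<union> R. (u, v) \<in> parcs H \<longleftrightarrow> (g u, g v) \<in> parcs G)"
      using sub gB by (intro exI[of _ g] conjI ballI) (erule inj_on_subset, assumption, blast, simp, blast)
  qed
  moreover have "order H = order G" using V by (simp add: order_def)
  ultimately show False using det H ne card_parcs_graph_iso[of G H] unfolding determined_by_def by blast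
qed

section \<open>Quantifier bounds for the exceptional graph\<close>

lemma is_cherry5E:
  assumes "is_cherry5 G"
  obtains c x y u v where "distinct [c, x, y, u, v]" "pverts G = {c, x, y, u, v}"
    "parcs G = {(c, x), (x, c), (c, y), (y, c)}"
proof -
  obtain e f where G: "pair_graph G" and n: "card (pverts G) = 5"
    and ef: "edges G = {e, f}" "e \<noteq> f" "e \<inter> f \<noteq> {}"
    using assms by (auto simp: is_cherry5_def order_def)
  have sy: "\<And>x y. (x, y) \<in> parcs G \<Longrightarrow> (y, x) \<in> parcs G" and irr: "\<And>x. (x, x) \<notin> parcs G"
    and sub: "parcs G \<subseteq> pverts G \<times> pverts G" and fin: "finite (pverts G)"
    using G by (auto simp: pair_graph_iff)
  obtain c where c: "c \<in> e" "c \<in> f" using ef by blast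
  have other: "\<exists>z. d = {c, z} \<and> (c, z) \<in> parcs G" if "d \<in> edges G" "c \<in> d" for d
    using that sy unfolding edges_def by auto
  obtain x where x: "e = {c, x}" "(c, x) \<in> parcs G" using other[of e] ef c by auto
  obtain y where y: "f = {c, y}" "(c, y) \<in> parcs G" using other[of f] ef c by auto
  have xy: "x \<noteq> y" "c \<noteq> x" "c \<noteq> y" using x y ef irr by auto
  have E: "parcs G = {(c, x), (x, c), (c, y), (y, c)}"
  proof
    show "parcs G \<subseteq> {(c, x), (x, c), (c, y), (y, c)}"
    proof
      fix a assume a: "a \<in> parcs G"
      obtain s t where st: "a = (s, t)" by (cases a)
      then have "{s, t} \<in> edges G" using a unfolding edges_def by blast
      then have "{s, t} = {c, x} \<or> {s, t} = {c, y}" using ef(1) x y by simp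
      then show "a \<in> {(c, x), (x, c), (c, y), (y, c)}" using st by (auto simp: doubleton_eq_iff)
    qed
    show "{(c, x), (x, c), (c, y), (y, c)} \<subseteq> parcs G" using x y sy by auto
  qed
  have cxy: "{c, x, y} \<subseteq> pverts G" using x y sub by auto
  have "card (pverts G - {c, x, y}) = 2" using n cxy xy by (simp add: card_Diff_subset)
  then obtain u v where uv: "pverts G - {c, x, y} = {u, v}" "u \<noteq> v" by (auto simp: card_2_iff)
  have "pverts G = {c, x, y, u, v}" using uv cxy by blast
  moreover have "distinct [c, x, y, u, v]" using uv xy by auto
  ultimately show ?thesis using E that by blast
qed

text \<open>Up to exchanging \<open>x\<close> with \<open>y\<close> and \<open>u\<close> with
  \<open>v\<close>, there are five kinds of pairs \<open>B\<close>. Each has its own competitor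
  graph with a different number of edges.\<close>

lemma is_cherry5_not_determined_by_2:
  assumes "is_cherry5 G" "B \<subseteq> pverts G" "card B = 2"
  shows "\<not> determined_by G 2 B"
proof -
  have G: "pair_graph G" using assms by (simp add: is_cherry5_def)
  obtain c x y u v where d: "distinct [c, x, y, u, v]" and V: "pverts G = {c, x, y, u, v}"
    and E: "parcs G = {(c, x), (x, c), (c, y), (y, c)}"
    using is_cherry5E[OF assms(1)] .
  \<comment> \<open>A predicate in the four names, so that each kind of pair is treated once and
    instantiated under the symmetries \<open>Cs\<close>.\<close>
  define C where "C x y u v \<longleftrightarrow> distinct [c, x, y, u, v] \<and> pverts G = {c, x, y, u, v} \<and>
    parcs G = {(c, x), (x, c), (c, y), (y, c)}" for x y u v
  have C: "C x y u v" unfolding C_def using d V E by blast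
  then have Cs: "C y x u v" "C x y v u" "C y x v u" unfolding C_def by auto
  \<comment> \<open>In the competitor every vertex outside \<open>B\<close> looks like
    \<open>u\<close> and \<open>v\<close>.\<close>
  have cx: "\<not> determined_by G 2 {c, x}" if "C x y u v" for x y u v
    by (rule not_determined_by_2I[OF G, where H = "\<lparr>pverts = pverts G, parcs = {(c, x), (x, c)}\<rparr>"])
      (use that in \<open>auto simp: C_def pair_graph_iff insert_Diff_if\<close>)
  \<comment> \<open>The added edge makes \<open>v\<close> look like \<open>x\<close> and
    \<open>y\<close>.\<close>
  have cu: "\<not> determined_by G 2 {c, u}" if "C x y u v" for x y u v
    by (rule not_determined_by_2I[OF G, where H = "\<lparr>pverts = pverts G,
        parcs = {(c, x), (x, c), (c, y), (y, c), (c, v), (v, c)}\<rparr>"])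
      (use that in \<open>auto simp: C_def pair_graph_iff insert_Diff_if\<close>)
  have xy: "\<not> determined_by G 2 {x, y}" if "C x y u v" for x y u v
    by (rule not_determined_by_2I[OF G, where H = "\<lparr>pverts = pverts G, parcs = {}\<rparr>"])
      (use that in \<open>auto simp: C_def pair_graph_iff insert_Diff_if\<close>)
  have xu: "\<not> determined_by G 2 {x, u}" if "C x y u v" for x y u v
    by (rule not_determined_by_2I[OF G, where H = "\<lparr>pverts = pverts G, parcs = {}\<rparr>"])
      (use that in \<open>auto simp: C_def pair_graph_iff insert_Diff_if\<close>)
  \<comment> \<open>Over the isolated vertices \<open>u\<close> and \<open>v\<close> all others look
    alike, and \<open>G\<close> has adjacent as well as non-adjacent pairs among them, so deleting
    one edge goes unnoticed.\<close>
  have uv: "\<not> determined_by G 2 {u, v}" if C: "C x y u v" for x y u v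
  proof (rule not_determined_by_2I[OF G])
    let ?H = "\<lparr>pverts = pverts G, parcs = {(c, x), (x, c)}\<rparr>"
    have D: "pverts G - {u, v} = {c, x, y}" and d: "distinct [c, x, y, u, v]"
      and E: "parcs G = {(c, x), (x, c), (c, y), (y, c)}"
      using C by (auto simp: C_def)
    show "pair_graph ?H" "{u, v} \<subseteq> pverts G" "pverts ?H = pverts G"
      using C by (auto simp: C_def pair_graph_iff)
    show "card (parcs G) \<noteq> card (parcs ?H)" using d by (simp add: E)
    show "card (pverts G - {u, v}) \<ge> 2" unfolding D using d by simp
    show "\<forall>a \<in> {u, v}. \<forall>b \<in> {u, v}. (a, b) \<in> parcs ?H \<longleftrightarrow> (a, b) \<in> parcs G"
      using d by (auto simp: E)
    have ex: "\<exists>p \<in> {c, x, y}. \<exists>q \<in> {c, x, y}. p \<noteq> q \<and> (b \<longleftrightarrow> (p, q) \<in> parcs G)" for b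
    proof (cases b)
      case True
      then show ?thesis using d by (intro bexI[of _ c] bexI[of _ x]) (auto simp: E)
    next
      case False
      then show ?thesis using d by (intro bexI[of _ x] bexI[of _ y]) (auto simp: E)
    qed
    have none: "(p, b) \<notin> parcs G" "(p, b) \<notin> parcs ?H" if "p \<in> {c, x, y}" "b \<in> {u, v}" for p b
      using that d by (auto simp: E)
    show "\<forall>p \<in> pverts G - {u, v}. \<forall>q \<in> pverts G - {u, v}. p \<noteq> q \<longrightarrow>
      (\<exists>p' \<in> pverts G - {u, v}. \<exists>q' \<in> pverts G - {u, v}. p' \<noteq> q' \<and> ((p, q) \<in> parcs ?H \<longleftrightarrow> (p', q') \<in> parcs G) \<and>
        (\<forall>b \<in> {u, v}. ((p, b) \<in> parcs ?H \<longleftrightarrow> (p', b) \<in> parcs G) \<and> ((q, b) \<in> parcs ?H \<longleftrightarrow> (q', b) \<in> parcs G)))"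
      unfolding D
    proof (intro ballI impI)
      fix p q assume pq: "p \<in> {c, x, y}" "q \<in> {c, x, y}"
      obtain p' q' where p'q': "p' \<in> {c, x, y}" "q' \<in> {c, x, y}" "p' \<noteq> q'"
        and e: "(p, q) \<in> parcs ?H \<longleftrightarrow> (p', q') \<in> parcs G"
        using ex[of "(p, q) \<in> parcs ?H"] by (elim bexE conjE)
      have "\<forall>b \<in> {u, v}. ((p, b) \<in> parcs ?H \<longleftrightarrow> (p', b) \<in> parcs G) \<and> ((q, b) \<in> parcs ?H \<longleftrightarrow> (q', b) \<in> parcs G)"
      proof
        fix b assume b: "b \<in> {u, v}"
        show "((p, b) \<in> parcs ?H \<longleftrightarrow> (p', b) \<in> parcs G) \<and> ((q, b) \<in> parcs ?H \<longleftrightarrow> (q', b) \<in> parcs G)"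
          by (simp only: none(1)[OF p'q'(1) b] none(1)[OF p'q'(2) b] none(2)[OF pq(1) b] none(2)[OF pq(2) b] simp_thms)
      qed
      then show "\<exists>p' \<in> {c, x, y}. \<exists>q' \<in> {c, x, y}. p' \<noteq> q' \<and> ((p, q) \<in> parcs ?H \<longleftrightarrow> (p', q') \<in> parcs G) \<and>
        (\<forall>b \<in> {u, v}. ((p, b) \<in> parcs ?H \<longleftrightarrow> (p', b) \<in> parcs G) \<and> ((q, b) \<in> parcs ?H \<longleftrightarrow> (q', b) \<in> parcs G))"
        using p'q' e by (intro bexI[OF _ p'q'(1)] bexI[OF _ p'q'(2)] conjI)
    qed
  qed
  obtain s t where B: "B = {s, t}" "s \<noteq> t" using assms(3) by (auto simp: card_2_iff)
  have "s \<in> {c, x, y, u, v}" "t \<in> {c, x, y, u, v}" using B assms(2) V by auto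
  then have "B \<in> {{c, x}, {c, y}, {c, u}, {c, v}, {x, y}, {x, u}, {x, v}, {y, u}, {y, v}, {u, v}}"
    using B by (elim insertE emptyE) (simp_all add: doubleton_eq_iff)
  then show ?thesis
    using cx[OF C] cx[OF Cs(1)] cu[OF C] cu[OF Cs(2)] xy[OF C] xu[OF C] xu[OF Cs(1)] xu[OF Cs(2)]
      xu[OF Cs(3)] uv[OF C] by auto
qed

text \<open>Pad \<open>A\<close> to \<open>4 - r\<close> vertices, leaving \<open>r + 1\<close>
  outside. For \<open>r < 2\<close> some pair of vertices is never tested as a whole and can be
  flipped; \<open>r = 2\<close> is the previous lemma.\<close>

lemma is_cherry5_not_determined_by:
  assumes G: "is_cherry5 G" and A: "A \<subseteq> pverts G" "card A + r \<le> 4" and r: "r \<le> 2"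
  shows "\<not> determined_by G r A"
proof
  assume det: "determined_by G r A"
  have pg: "pair_graph G" and n: "card (pverts G) = 5" using G by (auto simp: is_cherry5_def order_def)
  have fin: "finite (pverts G)" using pg by (simp add: pair_graph_iff)
  have le: "card A \<le> 4 - r" "4 - r \<le> card (pverts G)" using A n by auto
  obtain B where B: "A \<subseteq> B" "B \<subseteq> pverts G" "card B = 4 - r"
    using exists_subset_between[OF le A(1) fin] by blast
  have detB: "determined_by G r B" using det B(1) by (rule determined_by_superset)
  have finB: "finite B" using B(2) fin by (rule finite_subset)
  have cd: "card (pverts G - B) = Suc r" using B n r finB by (simp add: card_Diff_subset)
  consider "r = 0" | "r = 1" | "r = 2" using r by linarith
  then show False
  proof cases
    case 1
    then obtain p where p: "pverts G - B = {p}" using cd by (auto simp: card_Suc_eq)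
    have "B \<noteq> {}" using B 1 by auto
    then obtain q where q: "q \<in> B" by blast
    have "\<not> determined_by G 0 B"
    proof (rule not_determined_by_flip[OF pg _ _ _ B(2), of p q])
      fix R assume "R \<subseteq> pverts G" "card R \<le> 0"
      then have "R = {}" using fin by (simp add: finite_subset)
      then show "\<not> {p, q} \<subseteq> B \<union> R" using p by auto
    qed (use p q B in auto)
    then show False using detB 1 by simp
  next
    case 2
    then have "card (pverts G - B) = 2" using cd by simp
    then obtain p q where pq: "pverts G - B = {p, q}" "p \<noteq> q" by (auto simp: card_2_iff)
    have "\<not> determined_by G 1 B"
    proof (rule not_determined_by_flip[OF pg _ _ _ B(2), of p q])
      fix R assume R: "R \<subseteq> pverts G" "card R \<le> 1"
      show "\<not> {p, q} \<subseteq> B \<union> R"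
      proof
        assume "{p, q} \<subseteq> B \<union> R"
        then have "{p, q} \<subseteq> R" using pq by auto
        then have "card {p, q} \<le> card R" using R fin by (meson card_mono finite_subset)
        then show False using pq R by simp
      qed
    qed (use pq in auto)
    then show False using detB 2 by simp
  next
    case 3
    then show False using is_cherry5_not_determined_by_2[OF G B(2)] B(3) detB by simp
  qed
qed

lemma BS_restr_2_gt:
  assumes G: "pair_graph G" and ch: "is_cherry5 G \<or> is_cherry5 (complement_graph G)"
  shows "\<not> BS_restr 2 G \<le> enat 4"
proof -
  have "enat 5 \<le> enat (p + r)" if r: "r \<le> 2" and \<phi>: "bs_formula p r \<phi>" "identifies \<phi> G" for p r \<phi>
  proof (rule ccontr)
    assume "\<not> ?thesis"
    then have "p + r \<le> 4" by simp
    obtain A where A: "A \<subseteq> pverts G" "card A \<le> p" "determined_by G r A"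
      using identifies_imp_determined_by[OF \<phi>] by blast
    then have le: "card A + r \<le> 4" using \<open>p + r \<le> 4\<close> by linarith
    show False
      using ch
    proof
      assume "is_cherry5 G"
      then show False using is_cherry5_not_determined_by[OF _ A(1) le r] A(3) by blast
    next
      assume "is_cherry5 (complement_graph G)"
      then show False
        using is_cherry5_not_determined_by[of "complement_graph G" A r] A le r
          determined_by_complement[OF G A(3)] by simp
    qed
  qed
  then have "enat 5 \<le> BS_restr 2 G"
    unfolding BS_restr_def by (intro Inf_greatest) blast
  then have "BS_restr 2 G \<le> enat 4 \<Longrightarrow> enat 5 \<le> enat 4" by (rule order_trans)
  then show ?thesis by auto
qed

text \<open>Over the centre \<open>c\<close> the classes are the two end vertices and the two
  isolated ones. Both are twin pairs, of size less than 3.\<close>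

lemma is_cherry5_determined_by_3:
  assumes "is_cherry5 G"
  shows "\<exists>c \<in> pverts G. determined_by G 3 {c}"
proof -
  have G: "pair_graph G" using assms by (simp add: is_cherry5_def)
  obtain c x y u v where d: "distinct [c, x, y, u, v]" and V: "pverts G = {c, x, y, u, v}"
    and E: "parcs G = {(c, x), (x, c), (c, y), (y, c)}"
    using is_cherry5E[OF assms] .
  have B: "pverts G - {c} = {x, y, u, v}" using V d by auto
  have t: "ntype G {c} x = {c}" "ntype G {c} y = {c}" "ntype G {c} u = {}" "ntype G {c} v = {}"
    using d by (auto simp: ntype_def E)
  have "twins G x y" "twins G y x" "twins G u v" "twins G v u"
    using d by (auto simp: twins_iff V E)
  then have "twin_base G {c}"
    unfolding twin_base_def B using V t by (auto simp: twins_refl)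
  moreover have "\<forall>w \<in> {x, y, u, v}. card {z \<in> {x, y, u, v}. ntype G {c} z = ntype G {c} w} < 3"
  proof -
    have "{z \<in> {x, y, u, v}. ntype G {c} z = {c}} = {x, y}" "{z \<in> {x, y, u, v}. ntype G {c} z = {}} = {u, v}"
      using t by auto
    then show ?thesis using d by (simp add: t)
  qed
  ultimately have "determined_by G 3 {c}"
    by (intro twin_base_determined_by[OF G]) (simp_all only: B, simp)
  then show ?thesis using V by blast
qed

lemma BS_restr_3_le:
  assumes G: "pair_graph G" and ch: "is_cherry5 G \<or> is_cherry5 (complement_graph G)"
  shows "BS_restr 3 G \<le> 4"
proof -
  have "\<exists>c \<in> pverts G. determined_by G 3 {c}"
    using ch
  proof
    assume "is_cherry5 (complement_graph G)"
    then obtain c where "c \<in> pverts G" "determined_by (complement_graph G) 3 {c}"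
      using is_cherry5_determined_by_3 by fastforce
    then show ?thesis
      using determined_by_complement[OF pair_graph_complement[OF G]]
      by (auto simp: complement_graph_complement[OF G])
  qed (rule is_cherry5_determined_by_3)
  then obtain c where "c \<in> pverts G" "determined_by G 3 {c}" by blast
  then show ?thesis
    using BS_le(2)[OF G, of "{c}" 3 3] by (simp add: numeral_eq_enat)
qed

theorem theorem7p1:
  fixes G :: "'a pair_pre_digraph" and n :: nat
  assumes "pair_graph G" and "order G = n"
  shows "ereal_of_enat (BS G) \<le> ereal (3 * real n / 4 + 3 / 2) \<and>
    (n \<ge> 5 \<longrightarrow>
      (BS_restr 2 G \<le> enat (n - 1) \<longleftrightarrow>
        \<not> (is_cherry5 G \<or> is_cherry5 (complement_graph G)))) \<and>
    (is_cherry5 G \<or> is_cherry5 (complement_graph G) \<longrightarrow> BS_restr 3 G \<le> 4)"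
proof (intro conjI impI)
  show "ereal_of_enat (BS G) \<le> ereal (3 * real n / 4 + 3 / 2)"
    using assms by (rule BS_le_three_quarters)
  show "BS_restr 2 G \<le> enat (n - 1) \<longleftrightarrow> \<not> (is_cherry5 G \<or> is_cherry5 (complement_graph G))"
    if "n \<ge> 5"
  proof
    assume le: "BS_restr 2 G \<le> enat (n - 1)"
    show "\<not> (is_cherry5 G \<or> is_cherry5 (complement_graph G))"
    proof
      assume ch: "is_cherry5 G \<or> is_cherry5 (complement_graph G)"
      then have "n = 5" using assms(2) by (auto simp: is_cherry5_def order_def)
      then show False using le BS_restr_2_gt[OF assms(1) ch] by simp
    qed
  next
    assume "\<not> (is_cherry5 G \<or> is_cherry5 (complement_graph G))"
    then show "BS_restr 2 G \<le> enat (n - 1)"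
      using BS_restr_2_le[OF assms(1)] that assms(2) by (simp add: order_def)
  qed
  show "BS_restr 3 G \<le> 4" if "is_cherry5 G \<or> is_cherry5 (complement_graph G)"
    using assms(1) that by (rule BS_restr_3_le)
qed

end
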